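(* Let $F_d(w)=\sum_{n\ge0}x_n^{(d)}w^n$ and $A_d(w)=\sum_{n\ge0}A_{2n}^{(d)}w^n$. (a) For $d\ge2$, $A_d'/A_d$ is not an algebraic function, and $1/A_d$ is not holonomic. (b) For $d\ge3$, $1/F_d$ is not holonomic.
   Context: $A_{2n}^{(d)}$ is the number of closed walks of length $2n$ in $\mathbb Z^d$ (sequences of $2n$ steps among $\pm e_1,\dots,\pm e_d$ starting and ending at the origin; $A_0^{(d)}=1$), and $x_n^{(d)}=A_{2n}^{(d)}/\binom{2n}n$. A power series is algebraic if it is algebraic over $\mathbb C(w)$. A power series over $\mathbb C$ is holonomic if it satisfies a nontrivial linear ODE with coefficients in $\mathbb C(w)$, equivalently if its derivatives of all orders span a finite-dimensional vector space over $\mathbb C(w)$. *)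

theory Defs
  imports "HOL-Computational_Algebra.Computational_Algebra"
begin

text \<open>Vectors of $\mathbb{Z}^d$ are functions \<open>nat \<Rightarrow> int\<close> supported on \<open>{..<d}\<close>.\<close>

definition unit_vec :: "nat \<Rightarrow> nat \<Rightarrow> int" where
  "unit_vec i = (\<lambda>j. if j = i then 1 else 0)"

definition steps :: "nat \<Rightarrow> (nat \<Rightarrow> int) set" where
  "steps d = (\<Union>i<d. {unit_vec i, - unit_vec i})"

definition closed_walks :: "nat \<Rightarrow> nat \<Rightarrow> (nat \<Rightarrow> int) list set" where
  "closed_walks d m =
     {vs. length vs = m \<and> set vs \<subseteq> steps d \<and> (\<forall>j<d. (\<Sum>v\<leftarrow>vs. v j) = 0)}"

definition num_closed_walks :: "nat \<Rightarrow> nat \<Rightarrow> nat" where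
  "num_closed_walks d m = card (closed_walks d m)"

definition walk_ratio :: "nat \<Rightarrow> nat \<Rightarrow> complex" where
  "walk_ratio d n = of_nat (num_closed_walks d (2 * n)) / of_nat ((2 * n) choose n)"

definition A_series :: "nat \<Rightarrow> complex fps" where
  "A_series d = Abs_fps (\<lambda>n. of_nat (num_closed_walks d (2 * n)))"

definition F_series :: "nat \<Rightarrow> complex fps" where
  "F_series d = Abs_fps (walk_ratio d)"

text \<open>$\mathbb{C}(w)$ as a subfield of the field $\mathbb{C}((w))$ of formal Laurent series.\<close>

definition rational_fls :: "complex fls set" where
  "rational_fls =
     {fps_to_fls (fps_of_poly p) / fps_to_fls (fps_of_poly q) | p q. q \<noteq> 0}"

definition algebraic_fps :: "complex fps \<Rightarrow> bool" where
  "algebraic_fps f \<longleftrightarrow>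
     (\<exists>P :: complex fls poly. P \<noteq> 0 \<and> (\<forall>i. coeff P i \<in> rational_fls) \<and>
        poly P (fps_to_fls f) = 0)"

definition holonomic :: "complex fps \<Rightarrow> bool" where
  "holonomic f \<longleftrightarrow>
     (\<exists>(r :: nat) (c :: nat \<Rightarrow> complex fls).
        (\<forall>i\<le>r. c i \<in> rational_fls) \<and> (\<exists>i\<le>r. c i \<noteq> 0) \<and>
        (\<Sum>i\<le>r. c i * fps_to_fls ((fps_deriv ^^ i) f)) = 0)"

text \<open>
  Both series have constant coefficient 1, so the quotients by them in \<open>complex fps\<close>
  are genuine quotients of power series.
\<close>

lemma num_closed_walks_0: "num_closed_walks d 0 = 1"
proof -
  have "closed_walks d 0 = {[]}"
    by (auto simp: closed_walks_def)
  then show ?thesis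
    by (simp add: num_closed_walks_def)
qed

lemma A_series_nth_0: "fps_nth (A_series d) 0 = 1"
  by (simp add: A_series_def num_closed_walks_0)

lemma F_series_nth_0: "fps_nth (F_series d) 0 = 1"
  by (simp add: F_series_def walk_ratio_def num_closed_walks_0)

end

theory Submission
  imports Defs "HOL-Analysis.FPS_Convergence"
begin

text \<open>
  Let \<open>f = \<Sum> a n w^n\<close> be either series, \<open>h = 1/f\<close> and \<open>g = f'/f\<close>. The coefficients \<open>a n\<close> are
  integers with \<open>a 0 = 1\<close>: by splitting off one coordinate at a time
  (\<open>num_closed_walks_eq\<close>), \<open>A_2n\<close> is \<open>binomial (2n) n\<close> times the integer \<open>x n\<close> obtained by
  iterating \<open>y \<mapsto> (\<Sum>k. (binomial n k)^2 * y k)\<close>. So \<open>h\<close> and \<open>g\<close> are integer power series.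
  The claims say that there is no nontrivial relation \<open>\<Sum> c i * h^(i) = 0\<close> between the
  derivatives of \<open>h\<close>, and none of the form \<open>\<Sum> c i * g^i = 0\<close>, over C(w). A relation over C(w)
  is a linear system with integer coefficients in the coefficients of the \<open>c i\<close>, so that the
  \<open>c i\<close> may be taken in Z[w] (\<open>integer_relation_of_complex\<close>). It can then be reduced modulo
  every large prime \<open>p\<close>.

  Both sequences satisfy Lucas congruences \<open>a (n p + m) = a n * a m\<close> modulo \<open>p\<close>, because
  binomial coefficients do. Hence \<open>f = P * f(w^p)\<close> modulo \<open>p\<close>, where \<open>P\<close> is the truncation of
  \<open>f\<close> to degree less than \<open>p\<close>. As \<open>f(w^p)\<close> has derivative zero, \<open>g = P'/P\<close> modulo \<open>p\<close>: a rational
  function with simple poles at the zeros of \<open>P\<close>, whose residues are the multiplicities,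
  and these lie between \<open>1\<close> and \<open>p - 1\<close>. At such a zero \<open>g\<close> has a pole, and \<open>1/P\<close>, which is
  \<open>h\<close> up to a factor with derivative zero, has a pole of order \<open>m\<close>. Comparing leading terms, a
  relation of order \<open>s\<close> forces its top coefficient \<open>c s\<close> to vanish there, unless
  \<open>m (m + 1) \<dots> (m + s - 1)\<close> is zero modulo \<open>p\<close>. The latter needs \<open>m > p - s\<close>, and \<open>P\<close> has
  degree less than \<open>p\<close>, so there is at most one such zero. Thus the number of poles
  of \<open>g\<close> modulo \<open>p\<close> is at most \<open>degree (c s) + 1\<close>, independently of \<open>p\<close>
  (\<open>poly_log_derivative_mod_p\<close>, \<open>relation_imp_dvd_mod\<close>).

  A power series that is rational of bounded degree modulo infinitely many primes is
  rational, again because a linear system with integer coefficients decides it. So a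
  relation implies \<open>Q f' = N f\<close> with polynomials \<open>Q \<noteq> 0\<close> and \<open>N\<close>
  (\<open>log_derivative_rational\<close>).

  This contradicts the growth of \<open>a n\<close>, which lies between \<open>R^n / (n+1)^T\<close> and \<open>C R^n / (n+1)\<close>
  (\<open>no_first_order_equation\<close>). On the real axis left of \<open>1/R\<close>, if \<open>f'/f\<close> has no pole at \<open>1/R\<close>,
  then all derivatives of \<open>f\<close> stay bounded, against the lower bound. If it has a pole there,
  then \<open>f'\<close> is at least a positive multiple of \<open>f / (1/R - x)\<close>, so that \<open>f\<close> is unbounded; but
  the upper bound makes \<open>f'\<close> at most a multiple of \<open>1 / (1/R - x)\<close>, so that \<open>f\<close> is bounded. The
  upper bound is where \<open>d \<ge> 2\<close> and \<open>d \<ge> 3\<close> enter: \<open>A_1\<close> and \<open>F_2\<close> are both equal to the algebraic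
  series \<open>(1 - 4w)^(-1/2)\<close>, whose coefficients \<open>binomial (2n) n\<close> are larger than allowed.
\<close>

unbundle no vec_syntax
unbundle fps_syntax

section \<open>Integer polynomials modulo a prime\<close>

text \<open>
  The polynomial ring over the field with \<open>p\<close> elements is represented by integer polynomials up to
  multiples of \<open>of_nat p\<close>, because \<open>p\<close> varies in the proof while a type cannot depend on it.
  The following is divisibility in the quotient ring.
\<close>

definition dvd_mod :: "nat \<Rightarrow> 'a::comm_ring_1 \<Rightarrow> 'a \<Rightarrow> bool" where
  "dvd_mod p q f \<longleftrightarrow> (\<exists>a. of_nat p dvd f - q * a)"

lemma dvd_modI: "f = q * a + of_nat p * b \<Longrightarrow> dvd_mod p q f"
  unfolding dvd_mod_def by (rule exI[of _ a]) simp

lemma dvd_modE: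
  assumes "dvd_mod p q f"
  obtains a b where "f = q * a + of_nat p * b"
proof -
  obtain a b where "f - q * a = of_nat p * b"
    using assms unfolding dvd_mod_def dvd_def by blast
  then have "f = q * a + of_nat p * b"
    by (metis add_diff_cancel_left' diff_add_cancel add.commute)
  then show thesis by (rule that)
qed

lemma dvd_mod_refl: "dvd_mod p q q"
  by (rule dvd_modI[of _ _ 1 _ 0]) simp

lemma dvd_mod_of_modulus: "of_nat p dvd f \<Longrightarrow> dvd_mod p q f"
  by (auto simp: dvd_def intro: dvd_modI[of _ _ 0])

lemma dvd_imp_dvd_mod: "q dvd f \<Longrightarrow> dvd_mod p q f"
  by (auto simp: dvd_def intro: dvd_modI[of _ _ _ _ 0])

lemma dvd_mod_add: "dvd_mod p q f \<Longrightarrow> dvd_mod p q g \<Longrightarrow> dvd_mod p q (f + g)"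
proof (elim dvd_modE)
  fix a b c d assume "f = q * a + of_nat p * b" "g = q * c + of_nat p * d"
  then have "f + g = q * (a + c) + of_nat p * (b + d)" by (simp add: algebra_simps)
  then show ?thesis by (rule dvd_modI)
qed

lemma dvd_mod_mult: "dvd_mod p q f \<Longrightarrow> dvd_mod p q (c * f)"
proof (elim dvd_modE)
  fix a b assume "f = q * a + of_nat p * b"
  then have "c * f = q * (c * a) + of_nat p * (c * b)" by (simp add: algebra_simps)
  then show ?thesis by (rule dvd_modI)
qed

lemma dvd_mod_diff: "dvd_mod p q f \<Longrightarrow> dvd_mod p q g \<Longrightarrow> dvd_mod p q (f - g)"
  using dvd_mod_add[of p q f "-1 * g"] dvd_mod_mult[of p q g "-1"] by simp

lemma dvd_mod_trans: "dvd_mod p q r \<Longrightarrow> dvd_mod p r f \<Longrightarrow> dvd_mod p q f"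
proof (elim dvd_modE)
  fix a b c d assume "r = q * a + of_nat p * b" "f = r * c + of_nat p * d"
  then have "f = q * (a * c) + of_nat p * (b * c + d)" by (simp add: algebra_simps)
  then show ?thesis by (rule dvd_modI)
qed

lemma dvd_mod_cong: "of_nat p dvd f - g \<Longrightarrow> dvd_mod p q f \<longleftrightarrow> dvd_mod p q g"
  using dvd_mod_of_modulus[of p "f - g" q] dvd_mod_diff[of p q f "f - g"] dvd_mod_add[of p q "f - g" g]
  by auto

lemma dvd_mod_sum: "(\<And>i. i \<in> I \<Longrightarrow> dvd_mod p q (f i)) \<Longrightarrow> dvd_mod p q (sum f I)"
  by (induction I rule: infinite_finite_induct)
     (auto intro: dvd_mod_add dvd_mod_of_modulus)

lemma of_nat_dvd_poly_iff: "of_nat p dvd f \<longleftrightarrow> (\<forall>n. int p dvd coeff f n)"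
  for f :: "int poly"
  by (simp add: of_nat_poly const_poly_dvd_iff)

lemma monic_division:
  fixes f q :: "int poly"
  assumes "lead_coeff q = 1"
  obtains a r where "f = q * a + r" "r = 0 \<or> degree r < degree q"
proof -
  obtain a r where *: "pseudo_divmod f q = (a, r)" by force
  have "q \<noteq> 0" using assms by auto
  from pseudo_divmod[OF this *] assms that show thesis by simp
qed

text \<open>
  Reduced coefficients make congruent polynomials equal, so that the irreducible factors of a
  polynomial form a set without repetitions up to congruence.
\<close>

definition reduce :: "nat \<Rightarrow> int poly \<Rightarrow> int poly" where
  "reduce p f = map_poly (\<lambda>c. c mod int p) f"

lemma coeff_reduce [simp]: "coeff (reduce p f) n = coeff f n mod int p"
  by (simp add: reduce_def coeff_map_poly)

lemma reduce_cong: "of_nat p dvd f - reduce p f"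
  by (simp add: of_nat_dvd_poly_iff)

lemma reduce_cong_sym: "of_nat p dvd reduce p f - f"
  by (simp add: of_nat_dvd_poly_iff mod_eq_dvd_iff[symmetric])

lemma reduce_eq_iff: "reduce p f = reduce p g \<longleftrightarrow> of_nat p dvd f - g"
  by (simp add: poly_eq_iff of_nat_dvd_poly_iff mod_eq_dvd_iff)

lemma reduce_reduce: "reduce p (reduce p f) = reduce p f"
  by (simp add: reduce_eq_iff reduce_cong_sym)

lemma degree_reduce_le: "degree (reduce p f) \<le> degree f"
  by (rule degree_le) (simp add: coeff_eq_0)

context
  fixes p :: nat
  assumes p: "prime p"
begin

lemma prime_int_gt_1: "int p > 1"
  using prime_gt_1_nat[OF p] by simp

lemma monic_not_dvd: "lead_coeff f = 1 \<Longrightarrow> \<not> of_nat p dvd (f :: int poly)"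
  using prime_int_gt_1 unfolding of_nat_dvd_poly_iff by (metis zdvd_not_zless zero_less_one)

lemma monic_reduce:
  assumes "lead_coeff f = 1"
  shows "degree (reduce p f) = degree f" "lead_coeff (reduce p f) = 1"
proof -
  have "coeff (reduce p f) (degree f) = 1" using assms prime_int_gt_1 by simp
  then show "degree (reduce p f) = degree f" using degree_reduce_le[of p f]
    by (metis le_degree le_antisym zero_neq_one)
  then show "lead_coeff (reduce p f) = 1" using assms prime_int_gt_1 by simp
qed

lemma prime_elem_of_nat_poly: "prime_elem (of_nat p :: int poly)"
  using p by (simp add: of_nat_poly prime_elem_const_poly_iff)

lemma monic_degree_0: "degree f = 0 \<Longrightarrow> lead_coeff f = 1 \<Longrightarrow> f = 1"
  by (auto elim!: degree_eq_zeroE)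

lemma monic_diff_degree:
  fixes f g :: "int poly"
  assumes "lead_coeff f = 1" "lead_coeff g = 1" "degree f = degree g"
  shows "f - g = 0 \<or> degree (f - g) < degree g"
proof -
  have "degree (f - g) \<le> degree g" using assms degree_diff_le[of f "degree g" g] by simp
  moreover have "coeff (f - g) (degree g) = 0" using assms by simp
  ultimately show ?thesis using eq_zero_or_degree_less by blast
qed

lemma dvd_mult_cancel_mod:
  "of_nat p dvd (f * g :: int poly) \<Longrightarrow> \<not> of_nat p dvd f \<Longrightarrow> of_nat p dvd g"
  using prime_elem_of_nat_poly by (simp add: prime_elem_dvd_mult_iff)

text \<open>
  After reducing the coefficients of the cofactor, its leading coefficient is the leading
  coefficient of the product, and so cannot be cancelled by \<open>r\<close>.
\<close>

lemma monic_dvd_mod_small: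
  fixes q r :: "int poly"
  assumes q: "lead_coeff q = 1" and dvd: "dvd_mod p q r" and small: "r = 0 \<or> degree r < degree q"
  shows "of_nat p dvd r"
proof -
  obtain a b where r: "r = q * a + of_nat p * b" using dvd by (rule dvd_modE)
  define a' where "a' = reduce p a"
  obtain c where c: "a - a' = of_nat p * c" using reduce_cong[of p a] unfolding a'_def by (elim dvdE)
  have "r - q * a' = of_nat p * (q * c + b)"
    using c unfolding r by algebra
  then have *: "of_nat p dvd r - q * a'" by simp
  have "a' = 0"
  proof (rule ccontr)
    assume "a' \<noteq> 0"
    have "coeff r (degree q + degree a') = 0" using small by (auto simp: coeff_eq_0)
    then have "int p dvd lead_coeff a'"
      using * q by (auto simp: of_nat_dvd_poly_iff coeff_mult_degree_sum dest!: spec[of _ "degree q + degree a'"])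
    then have "lead_coeff a' mod int p = 0" by simp
    then have "lead_coeff a' = 0" by (metis a'_def coeff_reduce mod_mod_trivial)
    with \<open>a' \<noteq> 0\<close> show False by simp
  qed
  with * show ?thesis by simp
qed

lemma monic_dvd_mod_degree:
  fixes q f :: "int poly"
  assumes "lead_coeff q = 1" "dvd_mod p q f" "\<not> of_nat p dvd f"
  shows "degree q \<le> degree f"
  using monic_dvd_mod_small[OF assms(1,2)] assms(3) by force

lemma make_monic:
  fixes f :: "int poly"
  assumes "\<not> of_nat p dvd f"
  obtains u v g where "lead_coeff g = 1" "degree g \<le> degree f" "of_nat p dvd of_int u * f - g"
    "int p dvd u * v - 1"
proof -
  define f' where "f' = reduce p f"
  have "f' \<noteq> 0" using assms reduce_cong[of p f] by (auto simp: f'_def)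
  have "lead_coeff f' mod int p = lead_coeff f'" by (simp add: f'_def)
  then have "\<not> int p dvd lead_coeff f'" using \<open>f' \<noteq> 0\<close> by auto
  then have "coprime (int p) (lead_coeff f')" using p by (simp add: prime_imp_coprime)
  then obtain u k where u: "u * lead_coeff f' + k * int p = 1"
    by (metis bezout_int coprime_iff_gcd_eq_1 gcd.commute)
  define g where "g = reduce p (of_int u * f')"
  have co: "coeff (of_int u * f') n = u * coeff f' n" for n
    by (simp add: of_int_poly)
  have "u * lead_coeff f' mod int p = 1"
    using u prime_int_gt_1 by (metis mod_mult_self2 mod_pos_pos_trivial mult.commute zero_le_one)
  then have lc: "coeff g (degree f') = 1" by (simp add: g_def co)
  have "degree g \<le> degree (of_int u * f')" unfolding g_def by (rule degree_reduce_le)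
  also have "\<dots> \<le> degree f'" using degree_mult_le[of "of_int u" f'] by simp
  finally have "degree g = degree f'" using lc by (metis le_antisym le_degree zero_neq_one)
  moreover have "degree f' \<le> degree f" unfolding f'_def by (rule degree_reduce_le)
  moreover have "of_nat p dvd of_int u * (f - f') + (of_int u * f' - g)"
    unfolding f'_def g_def using reduce_cong by (intro dvd_add dvd_mult) auto
  then have "of_nat p dvd of_int u * f - g" by (simp add: algebra_simps)
  moreover have "int p dvd u * lead_coeff f' - 1"
    using u by (metis dvd_minus_iff dvd_triv_right minus_diff_eq add_diff_cancel_left')
  ultimately show thesis using lc that[of g u "lead_coeff f'"] by metis
qed

text \<open>
  Normalised representatives of the prime elements modulo \<open>p\<close>. Being prime, rather
  than irreducible, is what all applications use.
\<close>

definition prime_mod :: "int poly \<Rightarrow> bool" where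
  "prime_mod q \<longleftrightarrow> lead_coeff q = 1 \<and> degree q \<ge> 1 \<and> reduce p q = q \<and>
     (\<forall>a b. dvd_mod p q (a * b) \<longrightarrow> dvd_mod p q a \<or> dvd_mod p q b)"

lemma prime_modD:
  assumes "prime_mod q"
  shows "lead_coeff q = 1" "degree q \<ge> 1" "reduce p q = q" "q \<noteq> 0" "\<not> of_nat p dvd q"
    "dvd_mod p q (a * b) \<Longrightarrow> dvd_mod p q a \<or> dvd_mod p q b"
  using assms monic_not_dvd by (auto simp: prime_mod_def)

lemma prime_mod_not_dvd_one:
  assumes "prime_mod q" shows "\<not> dvd_mod p q 1"
  using monic_dvd_mod_degree[of q 1] monic_not_dvd[of 1] assms by (auto simp: prime_mod_def)

text \<open>
  The integer polynomials are not a principal ideal domain, but their quotient modulo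
  \<open>p\<close> is: an element of least degree, made monic, generates by division with
  remainder.
\<close>

lemma ideal_minimal_monic:
  fixes I :: "int poly set"
  assumes add: "\<And>f g. f \<in> I \<Longrightarrow> g \<in> I \<Longrightarrow> f + g \<in> I"
    and mult: "\<And>c f. f \<in> I \<Longrightarrow> c * f \<in> I"
    and modulus: "of_nat p \<in> I"
    and ex: "f0 \<in> I" "\<not> of_nat p dvd f0"
  obtains e where "e \<in> I" "lead_coeff e = 1"
    "\<And>f. f \<in> I \<Longrightarrow> dvd_mod p e f"
    "\<And>f. f \<in> I \<Longrightarrow> degree f < degree e \<Longrightarrow> of_nat p dvd f"
proof -
  have cong: "g \<in> I" if f: "f \<in> I" and fg: "of_nat p dvd f - g" for f g
  proof -
    obtain k where "f - g = of_nat p * k" using fg by (elim dvdE)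
    then have "g = f + (- k) * of_nat p" by (simp add: algebra_simps)
    then show ?thesis using add mult modulus f by metis
  qed
  obtain e0 where e0: "e0 \<in> I" "\<not> of_nat p dvd e0"
    and min: "\<And>f. f \<in> I \<Longrightarrow> \<not> of_nat p dvd f \<Longrightarrow> degree e0 \<le> degree f"
    using ex_has_least_nat[of "\<lambda>f. f \<in> I \<and> \<not> of_nat p dvd f" f0 degree] ex by blast
  from make_monic[OF e0(2)] obtain u v e where e: "lead_coeff e = 1" "degree e \<le> degree e0"
    "of_nat p dvd of_int u * e0 - e" "int p dvd u * v - 1" .
  have eI: "e \<in> I" using cong[OF mult[OF e0(1), of "of_int u"] e(3)] .
  have small: "of_nat p dvd f" if "f \<in> I" "degree f < degree e" for f
    using min[OF that(1)] that(2) e(2) by linarith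
  have "dvd_mod p e f" if f: "f \<in> I" for f
  proof -
    obtain a r where ar: "f = e * a + r" "r = 0 \<or> degree r < degree e"
      using monic_division[OF e(1)] .
    have "r = f + (- a) * e" using ar(1) by (simp add: algebra_simps)
    then have "r \<in> I" using add[OF f mult[OF eI, of "- a"]] by simp
    then have "of_nat p dvd r" using ar(2) small by auto
    then show ?thesis unfolding dvd_mod_def ar(1) by (intro exI[of _ a]) simp
  qed
  with that eI e(1) small show thesis by blast
qed

text \<open>
  A nonconstant divisor \<open>q\<close> of least degree is prime: if \<open>a\<close> is not a
  multiple of \<open>q\<close>, the generator of the ideal of \<open>a\<close> and
  \<open>q\<close> divides \<open>f\<close> and so is constant, and Bezout's identity
  \<open>1 = x a + y q\<close> multiplied by \<open>b\<close> shows that \<open>q\<close>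
  divides \<open>b\<close>.
\<close>

lemma exists_prime_mod_factor:
  fixes f :: "int poly"
  assumes f: "lead_coeff f = 1" "degree f \<ge> 1"
  obtains q where "prime_mod q" "dvd_mod p q f"
proof -
  define good where "good q \<longleftrightarrow> lead_coeff q = 1 \<and> degree q \<ge> 1 \<and> dvd_mod p q f" for q
  have "good f" using f by (simp add: good_def dvd_mod_refl)
  then obtain q0 where q0: "good q0" and min0: "\<And>r. good r \<Longrightarrow> degree q0 \<le> degree r"
    using ex_has_least_nat[of good f degree] by blast
  define q where "q = reduce p q0"
  have q: "lead_coeff q = 1" "degree q \<ge> 1" "degree q = degree q0" "reduce p q = q"
    using q0 monic_reduce[of q0] by (auto simp: good_def q_def reduce_reduce)
  have "dvd_mod p q q0"
    using dvd_mod_cong[of p q0 q q] reduce_cong[of p q0] dvd_mod_refl[of p q] by (simp add: q_def)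
  then have qf: "dvd_mod p q f" using q0 dvd_mod_trans unfolding good_def by blast
  have "dvd_mod p q b" if ab: "dvd_mod p q (a * b)" and na: "\<not> dvd_mod p q a" for a b
  proof -
    define I where "I = {x * a + y * q + of_nat p * z | x y z. True}"
    have "f + g \<in> I" if "f \<in> I" "g \<in> I" for f g
    proof -
      obtain x y z x' y' z' where "f = x * a + y * q + of_nat p * z"
        "g = x' * a + y' * q + of_nat p * z'" using \<open>f \<in> I\<close> \<open>g \<in> I\<close> by (auto simp: I_def)
      then have "f + g = (x + x') * a + (y + y') * q + of_nat p * (z + z')"
        by (simp add: algebra_simps)
      then show ?thesis unfolding I_def by blast
    qed
    moreover have "c * f \<in> I" if "f \<in> I" for c f
    proof -
      obtain x y z where "f = x * a + y * q + of_nat p * z" using \<open>f \<in> I\<close> by (auto simp: I_def)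
      then have "c * f = (c * x) * a + (c * y) * q + of_nat p * (c * z)"
        by (simp add: algebra_simps)
      then show ?thesis unfolding I_def by blast
    qed
    moreover have "of_nat p = 0 * a + 0 * q + of_nat p * 1" by simp
    then have "of_nat p \<in> I" unfolding I_def by blast
    moreover have "q = 0 * a + 1 * q + of_nat p * 0" by simp
    then have qI: "q \<in> I" unfolding I_def by blast
    moreover have "a = 1 * a + 0 * q + of_nat p * 0" by simp
    then have aI: "a \<in> I" unfolding I_def by blast
    ultimately obtain e where e: "e \<in> I" "lead_coeff e = 1" "\<And>f. f \<in> I \<Longrightarrow> dvd_mod p e f"
      and small: "\<And>f. f \<in> I \<Longrightarrow> degree f < degree e \<Longrightarrow> of_nat p dvd f"
      using ideal_minimal_monic[of I q] monic_not_dvd[OF q(1)] by metis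
    have le: "degree e \<le> degree q"
      using small[OF qI] monic_not_dvd[OF q(1)] by force
    show ?thesis
    proof (cases "degree e \<ge> 1")
      case True
      have "good e" unfolding good_def using True e(2) dvd_mod_trans[OF e(3)[OF qI] qf] by simp
      then have deg: "degree e = degree q" using min0 le q(3) by force
      have "degree (q - e) < degree e \<or> q - e = 0"
        using monic_diff_degree[OF q(1) e(2)] deg by auto
      moreover have "dvd_mod p e (q - e)" using e(3)[OF qI] dvd_mod_refl by (rule dvd_mod_diff)
      ultimately have "of_nat p dvd q - e" using monic_dvd_mod_small[OF e(2)] by blast
      then have "of_nat p dvd e - q" by (metis dvd_minus_iff minus_diff_eq)
      then have "dvd_mod p q e" using dvd_mod_cong dvd_mod_refl by blast
      then have "dvd_mod p q a" using e(3)[OF aI] dvd_mod_trans by blast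
      with na show ?thesis by simp
    next
      case False
      then have "e = 1" using e(2) by (simp add: monic_degree_0)
      then obtain x y z where "1 = x * a + y * q + of_nat p * z" using e(1) by (auto simp: I_def)
      then have "b = x * (a * b) + (q * (y * b) + of_nat p * (z * b))" by algebra
      moreover have "dvd_mod p q (q * (y * b) + of_nat p * (z * b))" by (rule dvd_modI) simp
      ultimately show ?thesis using dvd_mod_add dvd_mod_mult[OF ab] by metis
    qed
  qed
  then have "prime_mod q" unfolding prime_mod_def using q by blast
  with qf that show thesis by blast
qed

lemma prime_mod_eqI:
  assumes q: "prime_mod q" and r: "prime_mod r" and dvd: "dvd_mod p q r"
  shows "q = r"
proof -
  obtain k z where k: "r = q * k + of_nat p * z" using dvd by (rule dvd_modE)
  have "dvd_mod p r (q * k)"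
    by (rule dvd_modI[of _ _ 1 _ "- z"]) (simp add: k)
  then consider "dvd_mod p r q" | "dvd_mod p r k" using prime_modD(6)[OF r] by blast
  then have "dvd_mod p r q"
  proof cases
    case 2
    then obtain l y where l: "k = r * l + of_nat p * y" by (rule dvd_modE)
    have "r * (1 - q * l) = of_nat p * (q * y + z)" using k unfolding l by algebra
    then have "of_nat p dvd 1 - q * l"
      using dvd_mult_cancel_mod[of r "1 - q * l"] prime_modD(5)[OF r] by simp
    then have "dvd_mod p q 1" unfolding dvd_mod_def by blast
    with prime_mod_not_dvd_one[OF q] show ?thesis by simp
  qed
  then have deg: "degree q = degree r"
    using monic_dvd_mod_degree[OF prime_modD(1)[OF q] dvd prime_modD(5)[OF r]]
      monic_dvd_mod_degree[OF prime_modD(1)[OF r] _ prime_modD(5)[OF q]] by (intro le_antisym) auto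
  then have "r - q = 0 \<or> degree (r - q) < degree q"
    by (intro monic_diff_degree prime_modD(1)[OF q] prime_modD(1)[OF r]) simp
  moreover have "dvd_mod p q (r - q)" using dvd dvd_mod_refl by (rule dvd_mod_diff)
  ultimately have "of_nat p dvd r - q" using monic_dvd_mod_small[OF prime_modD(1)[OF q]] by blast
  then have "reduce p r = reduce p q" by (simp add: reduce_eq_iff)
  then show ?thesis using prime_modD(3)[OF q] prime_modD(3)[OF r] by simp
qed

lemma prime_mod_dvd_prod:
  assumes "prime_mod q" "finite S" "dvd_mod p q (\<Prod>S)"
  shows "\<exists>r\<in>S. dvd_mod p q r"
  using assms(2,3)
proof (induction S rule: finite_induct)
  case empty
  then show ?case using prime_mod_not_dvd_one[OF assms(1)] by simp
next
  case (insert r S)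
  then show ?case using prime_modD(6)[OF assms(1), of r "\<Prod>S"] by auto
qed

lemma prime_mod_factorization:
  assumes "lead_coeff f = 1"
  shows "\<exists>M. (\<forall>q\<in>#M. prime_mod q) \<and> of_nat p dvd f - \<Prod>\<^sub># M"
  using assms
proof (induction "degree f" arbitrary: f rule: less_induct)
  case less
  show ?case
  proof (cases "degree f \<ge> 1")
    case False
    then have "f = 1" using less.prems by (simp add: monic_degree_0)
    then show ?thesis by (intro exI[of _ "{#}"]) simp
  next
    case True
    then obtain q where q: "prime_mod q" "dvd_mod p q f"
      using exists_prime_mod_factor less.prems by blast
    obtain k r where k: "f = q * k + r" "r = 0 \<or> degree r < degree q"
      using monic_division[OF prime_modD(1)[OF q(1)]] .
    have "dvd_mod p q (f - q * k)"
      by (rule dvd_mod_diff[OF q(2) dvd_imp_dvd_mod]) simp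
    then have r: "of_nat p dvd r"
      using monic_dvd_mod_small[OF prime_modD(1)[OF q(1)] _ k(2)] k(1) by simp
    have le: "degree q \<le> degree f"
      using monic_dvd_mod_degree q prime_modD(1) monic_not_dvd less.prems by blast
    have "k \<noteq> 0" using k(1) r monic_not_dvd[OF less.prems] by auto
    then have dk: "degree (q * k) = degree q + degree k" using prime_modD(4)[OF q(1)]
      by (simp add: degree_mult_eq)
    then have "degree f = degree q + degree k" using k le
      by (metis add.commute add_0 degree_add_eq_left le_add1 order_less_le_trans)
    moreover have "coeff r (degree f) = 0" using k(2) le by (auto simp: coeff_eq_0)
    ultimately have "lead_coeff k = 1" "degree k < degree f"
      using less.prems prime_modD(1,2)[OF q(1)] k(1) coeff_mult_degree_sum[of q k] by auto
    then obtain M where M: "\<forall>q\<in>#M. prime_mod q" "of_nat p dvd k - \<Prod>\<^sub># M" using less.hyps by blast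
    have "of_nat p dvd q * (k - \<Prod>\<^sub># M) + r" using M r by (intro dvd_add dvd_mult)
    then have "of_nat p dvd f - \<Prod>\<^sub># (add_mset q M)" unfolding k(1) by (simp add: algebra_simps)
    then show ?thesis using M(1) q(1) by (intro exI[of _ "add_mset q M"]) auto
  qed
qed

lemma prod_dvd_mod:
  assumes "finite S" "\<And>q. q \<in> S \<Longrightarrow> prime_mod q" "\<And>q. q \<in> S \<Longrightarrow> dvd_mod p q c"
  shows "dvd_mod p (\<Prod>S) c"
  using assms
proof (induction S rule: finite_induct)
  case empty
  show ?case by (intro dvd_imp_dvd_mod) simp
next
  case (insert q S)
  then obtain k z where k: "c = \<Prod>S * k + of_nat p * z" by (meson dvd_modE insertCI)
  have q: "prime_mod q" "dvd_mod p q c" using insert.prems by auto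
  have "dvd_mod p q (c - of_nat p * z)"
    by (rule dvd_mod_diff[OF q(2) dvd_mod_of_modulus]) simp
  then have "dvd_mod p q (\<Prod>S) \<or> dvd_mod p q k" using k prime_modD(6)[OF q(1)] by simp
  moreover have "\<not> dvd_mod p q (\<Prod>S)"
    using prime_mod_dvd_prod[OF q(1) insert.hyps(1)] prime_mod_eqI[OF q(1)] insert by blast
  ultimately obtain l y where "k = q * l + of_nat p * y" by (meson dvd_modE)
  then have "c = \<Prod>(insert q S) * l + of_nat p * (\<Prod>S * y + z)"
    using k insert.hyps by (simp add: algebra_simps)
  then show ?case by (rule dvd_modI)
qed

lemma prime_mod_pderiv:
  assumes q: "prime_mod q" and deg: "degree q < p"
  shows "\<not> dvd_mod p q (pderiv q)"
proof
  assume dvd: "dvd_mod p q (pderiv q)"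
  have "degree (pderiv q) < degree q" using prime_modD(2)[OF q] by (simp add: degree_pderiv)
  then have "of_nat p dvd pderiv q" using monic_dvd_mod_small[OF prime_modD(1)[OF q] dvd] by simp
  then have "int p dvd coeff (pderiv q) (degree q - 1)" by (simp add: of_nat_dvd_poly_iff)
  then have "int p dvd int (degree q)"
    using prime_modD(1,2)[OF q] by (simp add: coeff_pderiv)
  then have "p dvd degree q" by simp
  then show False using deg prime_modD(2)[OF q] by (auto dest: dvd_imp_le)
qed

text \<open>
  The numerator over the common denominator \<open>\<Prod>S\<close> of
  \<open>\<Sum>q\<in>S. m q * q'/q\<close>, the logarithmic derivative of
  \<open>\<Prod>q\<in>S. q ^ m q\<close>. The simple pole at the zeros of \<open>q\<close> has
  residue \<open>m q\<close>.
\<close>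

definition log_numerator :: "int poly set \<Rightarrow> (int poly \<Rightarrow> nat) \<Rightarrow> int poly" where
  "log_numerator S m = (\<Sum>q\<in>S. of_nat (m q) * pderiv q * \<Prod>(S - {q}))"

lemma log_numerator:
  assumes "finite S"
  shows "\<Prod>S * pderiv (\<Prod>q\<in>S. q ^ m q) = log_numerator S m * (\<Prod>q\<in>S. q ^ m q)"
proof -
  have "\<Prod>S * (\<Prod>r\<in>S - {q}. r ^ m r) * pderiv (q ^ m q) =
      of_nat (m q) * pderiv q * \<Prod>(S - {q}) * (\<Prod>q\<in>S. q ^ m q)" if "q \<in> S" for q
  proof (cases "m q")
    case (Suc k)
    have "\<Prod>S = q * \<Prod>(S - {q})" using assms that by (rule prod.remove)
    moreover have "(\<Prod>q\<in>S. q ^ m q) = q ^ m q * (\<Prod>r\<in>S - {q}. r ^ m r)"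
      using assms that by (rule prod.remove)
    moreover have "pderiv (q ^ m q) = of_nat (Suc k) * q ^ k * pderiv q"
      unfolding Suc pderiv_power_Suc by (simp add: of_nat_poly)
    ultimately show ?thesis unfolding Suc by (simp add: algebra_simps)
  qed simp
  then show ?thesis
    unfolding log_numerator_def pderiv_prod sum_distrib_left sum_distrib_right
    by (intro sum.cong refl) (simp add: mult.assoc)
qed

text \<open>
  Adding the logarithmic derivative of \<open>(\<Prod>S) ^ i\<close> raises every residue by
  \<open>i\<close>.
\<close>

lemma log_numerator_add:
  "log_numerator S m + of_nat i * pderiv (\<Prod>S) = log_numerator S (\<lambda>q. m q + i)"
proof -
  have "pderiv (\<Prod>S) = (\<Sum>q\<in>S. \<Prod>(S - {q}) * pderiv q)"
    using pderiv_prod[of "\<lambda>q. q" S] by simp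
  then show ?thesis
    by (simp add: log_numerator_def sum_distrib_left sum.distrib[symmetric] algebra_simps)
qed

text \<open>
  All summands but the one of \<open>q\<close> itself are multiples of \<open>q\<close>, so a
  vanishing numerator at \<open>q\<close> means a vanishing residue.
\<close>

lemma dvd_mod_log_numerator:
  assumes S: "finite S" "\<And>r. r \<in> S \<Longrightarrow> prime_mod r" and q: "q \<in> S" "degree q < p"
    and dvd: "dvd_mod p q (log_numerator S m)"
  shows "p dvd m q"
proof -
  have qp: "prime_mod q" using S q by simp
  let ?t = "\<lambda>r. of_nat (m r) * pderiv r * \<Prod>(S - {r})"
  have sum: "dvd_mod p q (\<Sum>r\<in>S - {q}. ?t r)"
  proof (intro dvd_mod_sum dvd_imp_dvd_mod dvd_mult)
    fix r assume "r \<in> S - {q}"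
    then show "q dvd \<Prod>(S - {r})" using S q by (intro dvd_prodI) auto
  qed
  have "log_numerator S m = ?t q + (\<Sum>r\<in>S - {q}. ?t r)"
    unfolding log_numerator_def using S(1) q(1) by (rule sum.remove)
  then have "dvd_mod p q (?t q)" using dvd_mod_diff[OF dvd sum] by simp
  moreover have "\<not> dvd_mod p q (\<Prod>(S - {q}))"
    using prime_mod_dvd_prod[OF qp, of "S - {q}"] prime_mod_eqI[OF qp] S by blast
  moreover have "\<not> dvd_mod p q (pderiv q)" using prime_mod_pderiv[OF qp q(2)] .
  ultimately have "dvd_mod p q (of_nat (m q))" using prime_modD(6)[OF qp] by blast
  then have "of_nat p dvd (of_nat (m q) :: int poly)"
    using prime_modD(2)[OF qp] by (intro monic_dvd_mod_small[OF prime_modD(1)[OF qp]]) auto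
  then have "int p dvd coeff (of_nat (m q)) 0" unfolding of_nat_dvd_poly_iff by blast
  then show ?thesis by (simp add: of_nat_poly)
qed

lemma monic_cong_degree:
  assumes "lead_coeff f = 1" "lead_coeff g = 1" "of_nat p dvd f - (g :: int poly)"
  shows "degree f = degree g"
proof -
  have "reduce p f = reduce p g" using assms(3) by (simp add: reduce_eq_iff)
  then show ?thesis using monic_reduce(1)[OF assms(1)] monic_reduce(1)[OF assms(2)] by simp
qed

text \<open>
  How the degree of a denominator gets bounded. The quotient \<open>N/Q\<close> has simple poles,
  and \<open>N + e * Q'\<close> vanishes at those with residue \<open>-e\<close>. The
  hypothesis on \<open>c\<close> says that at each pole either \<open>c\<close> vanishes or the
  residue is one of the \<open>-e i\<close>. For a logarithmic derivative of a polynomial of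
  degree less than \<open>p\<close>, the second case is rare. Relations between derivatives use
  \<open>e i = i\<close>, algebraic relations use \<open>e i = 0\<close>.
\<close>

definition pole_test :: "int poly \<Rightarrow> int poly \<Rightarrow> bool" where
  "pole_test Q N \<longleftrightarrow> (\<forall>c s e. \<not> of_nat p dvd c \<longrightarrow> 2 * s \<le> p \<longrightarrow> (\<forall>i<s. e i < s) \<longrightarrow>
     dvd_mod p Q (c * (\<Prod>i<s. N + of_nat (e i) * pderiv Q)) \<longrightarrow> degree Q \<le> degree c + 1)"

text \<open>
  With \<open>P = \<Prod>q\<in>S. q ^ m q\<close> modulo \<open>p\<close>, the residues are
  the multiplicities \<open>m q < p\<close>. A residue congruent to \<open>-e\<close> with
  \<open>e < s\<close> means \<open>m q > p - s\<close>, which is more than half of the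
  degree available to \<open>P\<close> as soon as \<open>2 s \<le> p\<close>. So these
  exceptional factors \<open>q\<close> contribute at most \<open>1\<close> to the degree of
  \<open>\<Prod>S\<close>, and all others divide \<open>c\<close>.
\<close>

lemma poly_log_derivative_mod_p:
  fixes P :: "int poly"
  assumes P: "lead_coeff P = 1" "degree P < p"
  obtains Q N where "lead_coeff Q = 1" "degree N \<le> degree Q" "of_nat p dvd Q * pderiv P - N * P"
    "pole_test Q N"
proof -
  obtain M where M: "\<forall>q\<in>#M. prime_mod q" "of_nat p dvd P - \<Prod>\<^sub># M"
    using prime_mod_factorization[OF P(1)] by blast
  define S where "S = set_mset M"
  define m where "m = count M"
  define P1 where "P1 = (\<Prod>q\<in>S. q ^ m q)"
  define N where "N = log_numerator S m"
  have S: "finite S" and prime: "\<And>q. q \<in> S \<Longrightarrow> prime_mod q" and m_pos: "\<And>q. q \<in> S \<Longrightarrow> m q \<ge> 1"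
    using M(1) by (auto simp: S_def m_def Suc_le_eq)
  have cong: "of_nat p dvd P - P1" using M(2) by (simp add: P1_def S_def m_def prod_mset_multiplicity)
  have lcP1: "lead_coeff P1 = 1" using prime_modD(1)[OF prime]
    by (simp add: P1_def lead_coeff_prod lead_coeff_power)
  have lcQ: "lead_coeff (\<Prod>T) = 1" "degree (\<Prod>T) = (\<Sum>q\<in>T. degree q)" if "T \<subseteq> S" for T
  proof -
    have *: "q \<noteq> 0" "lead_coeff q = 1" if "q \<in> T" for q
      using prime_modD(1,4)[OF prime] that \<open>T \<subseteq> S\<close> by blast+
    then show "lead_coeff (\<Prod>T) = 1" by (simp add: lead_coeff_prod)
    show "degree (\<Prod>T) = (\<Sum>q\<in>T. degree q)" using *(1) by (intro degree_prod_sum_eq) auto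
  qed
  have "degree P1 = (\<Sum>q\<in>S. m q * degree q)"
    unfolding P1_def using prime_modD(4)[OF prime] by (simp add: degree_prod_sum_eq degree_power_eq)
  then have degP: "(\<Sum>q\<in>S. m q * degree q) < p"
    using monic_cong_degree[OF P(1) lcP1 cong] P(2) by simp
  have le: "m q * degree q < p" if "q \<in> S" for q
    using degP member_le_sum[of q S "\<lambda>q. m q * degree q"] that S by force
  have m_less: "m q < p" and deg_less: "degree q < p" if "q \<in> S" for q
    using le[OF that] prime_modD(2)[OF prime[OF that]] m_pos[OF that]
    by (metis One_nat_def Suc_le_eq le_less_trans mult.right_neutral mult_le_mono2 mult.commute)+
  show thesis
  proof (rule that)
    show "lead_coeff (\<Prod>S) = 1" using lcQ by simp
    show "degree N \<le> degree (\<Prod>S)" unfolding N_def log_numerator_def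
    proof (rule degree_sum_le[OF S])
      fix q assume q: "q \<in> S"
      have "degree (of_nat (m q) * pderiv q * \<Prod>(S - {q})) \<le> degree q + degree (\<Prod>(S - {q}))"
      proof (rule order_trans[OF degree_mult_le add_right_mono])
        have "degree (of_nat (m q) * pderiv q) \<le> degree (of_nat (m q) :: int poly) + degree (pderiv q)"
          by (rule degree_mult_le)
        then show "degree (of_nat (m q) * pderiv q) \<le> degree q" by (simp add: degree_pderiv)
      qed
      also have "\<dots> = degree (\<Prod>S)" using lcQ S q by (simp add: sum.remove)
      finally show "degree (of_nat (m q) * pderiv q * \<Prod>(S - {q})) \<le> degree (\<Prod>S)" .
    qed
    obtain z where z: "P = P1 + of_nat p * z" using cong
      by (metis diff_eq_eq add.commute dvdE)
    have "\<Prod>S * pderiv P1 = N * P1" unfolding P1_def N_def by (rule log_numerator[OF S])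
    then have "\<Prod>S * pderiv P - N * P = of_nat p * (\<Prod>S * pderiv z - N * z)"
      unfolding z pderiv_add by (simp add: pderiv_mult algebra_simps)
    then show "of_nat p dvd \<Prod>S * pderiv P - N * P" by simp
  next
    show "pole_test (\<Prod>S) N" unfolding pole_test_def
    proof (intro allI impI)
      fix c s and e :: "nat \<Rightarrow> nat"
      assume c: "\<not> of_nat p dvd c" and s: "2 * s \<le> p" and e: "\<forall>i<s. e i < s"
        and dvd: "dvd_mod p (\<Prod>S) (c * (\<Prod>i<s. N + of_nat (e i) * pderiv (\<Prod>S)))"
      \<comment> \<open>the primes that divide \<open>c\<close>, and the exceptional ones\<close>
      define S1 where "S1 = {q\<in>S. dvd_mod p q c}"
      define S2 where "S2 = S - S1"
      have big: "p + 1 \<le> m q + s" if q: "q \<in> S2" for q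
      proof -
        have qS: "q \<in> S" and nc: "\<not> dvd_mod p q c" using q by (auto simp: S2_def S1_def)
        have "dvd_mod p q (\<Prod>S)" using S qS by (intro dvd_imp_dvd_mod dvd_prodI)
        then have "dvd_mod p q (c * (\<Prod>i<s. N + of_nat (e i) * pderiv (\<Prod>S)))"
          using dvd dvd_mod_trans by blast
        then have "dvd_mod p q (\<Prod>i<s. log_numerator S (\<lambda>q. m q + e i))"
          using nc prime_modD(6)[OF prime[OF qS]] unfolding N_def log_numerator_add by blast
        moreover have "\<exists>i<n. dvd_mod p q (g i)" if "dvd_mod p q (\<Prod>i<n. g i)" for n :: nat and g :: "nat \<Rightarrow> int poly"
          using that
        proof (induction n)
          case 0
          then show ?case using prime_mod_not_dvd_one[OF prime[OF qS]] by simp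
        next
          case (Suc n)
          then show ?case using prime_modD(6)[OF prime[OF qS]] by (auto simp: less_Suc_eq)
        qed
        ultimately obtain i where i: "i < s" "dvd_mod p q (log_numerator S (\<lambda>q. m q + e i))" by blast
        have "p dvd m q + e i"
          using dvd_mod_log_numerator[OF S prime qS deg_less[OF qS] i(2)] .
        then have "p \<le> m q + e i" using m_pos[OF qS] by (intro dvd_imp_le) auto
        moreover have "e i < s" using e i(1) by blast
        ultimately show ?thesis by simp
      qed
      have "S2 \<subseteq> S" "finite S2" using S by (auto simp: S2_def)
      have deg2: "degree (\<Prod>S2) \<le> 1"
      proof (rule ccontr)
        assume "\<not> ?thesis"
        then have "2 \<le> (\<Sum>q\<in>S2. degree q)" using lcQ[OF \<open>S2 \<subseteq> S\<close>] by simp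
        then have "(p + 1 - s) * 2 \<le> (p + 1 - s) * (\<Sum>q\<in>S2. degree q)" by (rule mult_le_mono2)
        also have "\<dots> \<le> (\<Sum>q\<in>S2. m q * degree q)" unfolding sum_distrib_left
          using big by (intro sum_mono mult_le_mono1) force
        also have "\<dots> \<le> (\<Sum>q\<in>S. m q * degree q)" using \<open>S2 \<subseteq> S\<close> S by (intro sum_mono2) auto
        also have "\<dots> < p" by (rule degP)
        finally show False using s by simp
      qed
      have "S1 \<subseteq> S" by (auto simp: S1_def)
      have "dvd_mod p (\<Prod>S1) c"
        by (rule prod_dvd_mod) (use S prime in \<open>auto simp: S1_def\<close>)
      then have deg1: "degree (\<Prod>S1) \<le> degree c"
        using monic_dvd_mod_degree lcQ(1)[OF \<open>S1 \<subseteq> S\<close>] c by blast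
      have "degree (\<Prod>S) = degree (\<Prod>S1) + degree (\<Prod>S2)"
        using lcQ[OF \<open>S1 \<subseteq> S\<close>] lcQ[OF \<open>S2 \<subseteq> S\<close>] lcQ[of S] S
        by (simp add: S2_def sum.subset_diff[OF \<open>S1 \<subseteq> S\<close> S])
      with deg1 deg2 show "degree (\<Prod>S) \<le> degree c + 1" by simp
    qed
  qed
qed

end

section \<open>Integer power series modulo a prime\<close>

lemma of_nat_dvd_fps_iff: "of_nat p dvd F \<longleftrightarrow> (\<forall>n. int p dvd F $ n)" for F :: "int fps"
proof
  assume "of_nat p dvd F"
  then obtain G where "F = fps_const (int p) * G" by (auto simp: fps_of_nat elim: dvdE)
  then show "\<forall>n. int p dvd F $ n" by simp
next
  assume *: "\<forall>n. int p dvd F $ n"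
  have "F = fps_const (int p) * Abs_fps (\<lambda>n. F $ n div int p)"
    using * by (intro fps_ext) simp
  then show "of_nat p dvd F" by (metis dvd_triv_left fps_of_nat of_nat_id of_int_of_nat_eq)
qed

lemma of_nat_dvd_fps_of_poly: "of_nat p dvd fps_of_poly f \<longleftrightarrow> of_nat p dvd f" for f :: "int poly"
  by (simp add: of_nat_dvd_fps_iff of_nat_dvd_poly_iff)

lemma of_nat_dvd_fps_deriv: "of_nat p dvd F \<Longrightarrow> of_nat p dvd fps_deriv F" for F :: "int fps"
  by (simp add: of_nat_dvd_fps_iff)

lemma fps_of_poly_of_int: "fps_of_poly (of_int c) = of_int c"
  by (simp add: of_int_poly fps_of_poly_const fps_of_int)

lemma fps_of_poly_of_nat: "fps_of_poly (of_nat c) = of_nat c"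
  by (simp add: of_nat_poly fps_of_poly_const fps_of_nat)

lemma fps_of_poly_mult_nth:
  fixes c :: "'a::comm_ring_1 poly"
  assumes "degree c \<le> D"
  shows "(fps_of_poly c * F) $ n = (\<Sum>j\<le>D. coeff c j * (if j \<le> n then F $ (n - j) else 0))"
proof -
  have "(fps_of_poly c * F) $ n = (\<Sum>j\<in>{..n}. coeff c j * F $ (n - j))"
    by (simp add: fps_mult_nth atLeast0AtMost)
  also have "\<dots> = (\<Sum>j\<in>{..max n D}. coeff c j * (if j \<le> n then F $ (n - j) else 0))"
    by (rule sum.mono_neutral_cong_left) auto
  also have "\<dots> = (\<Sum>j\<le>D. coeff c j * (if j \<le> n then F $ (n - j) else 0))"
    using assms by (intro sum.mono_neutral_right) (auto simp: coeff_eq_0)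
  finally show ?thesis .
qed

section \<open>Integer solutions of linear systems\<close>

text \<open>
  The solutions sought are compared with solutions in an additive group: the complex numbers, or
  the integers modulo \<open>p\<close>. Both are given as a ring together with the set
  \<open>Z\<close> of the elements that count as zero. Saturation says that multiplication by
  \<open>k\<close> is injective on the quotient.
\<close>

definition saturated :: "int \<Rightarrow> 'a::comm_ring_1 set \<Rightarrow> bool" where
  "saturated k Z \<longleftrightarrow> (\<forall>a\<in>Z. \<forall>b\<in>Z. a + b \<in> Z) \<and> (\<forall>a\<in>Z. \<forall>c. of_int c * a \<in> Z) \<and>
     (\<forall>a. of_int k * a \<in> Z \<longrightarrow> a \<in> Z)"

lemma saturatedD:
  assumes "saturated k Z"
  shows "a \<in> Z \<Longrightarrow> b \<in> Z \<Longrightarrow> a + b \<in> Z" "a \<in> Z \<Longrightarrow> of_int c * a \<in> Z" "of_int k * a \<in> Z \<Longrightarrow> a \<in> Z"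
  using assms unfolding saturated_def by blast+

lemma saturated_diff:
  assumes "saturated k Z" "a \<in> Z" "b \<in> Z" shows "a - b \<in> Z"
  using saturatedD(1)[OF assms(1,2) saturatedD(2)[OF assms(1,3), of "-1"]] by simp

lemma saturated_sum:
  assumes "saturated k Z" "finite I" "\<And>i. i \<in> I \<Longrightarrow> x i \<in> Z" "I \<noteq> {}"
  shows "(\<Sum>i\<in>I. of_int (c i) * x i) \<in> Z"
  using assms(2,4,3)
proof (induction rule: finite_ne_induct)
  case (singleton i)
  then show ?case using saturatedD(2)[OF assms(1)] by simp
next
  case (insert i I)
  have "of_int (c i) * x i \<in> Z" using insert.prems by (intro saturatedD(2)[OF assms(1)]) simp
  moreover have "(\<Sum>i\<in>I. of_int (c i) * x i) \<in> Z" using insert.prems by (intro insert.IH) simp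
  ultimately show ?case using saturatedD(1)[OF assms(1)] insert.hyps by simp
qed

text \<open>
  Gaussian elimination of one unknown at a time only divides by integers. Each division uses up
  the pivot, which is why a quotient without \<open>k\<close>-torsion is required for every
  \<open>k \<noteq> 0\<close>, and the quotient may depend on \<open>k\<close>: modulo primes,
  any prime that does not divide \<open>k\<close> will do.
\<close>

lemma integer_solution:
  fixes I :: "'i set" and Rows :: "('i \<Rightarrow> int) set"
  assumes "finite I"
    and "\<And>k. k \<noteq> 0 \<Longrightarrow> \<exists>(Z :: 'a::comm_ring_1 set) x. saturated k Z \<and> (\<exists>i\<in>I. x i \<notin> Z) \<and>
           (\<forall>R\<in>Rows. (\<Sum>i\<in>I. of_int (R i) * x i) \<in> Z)"
  shows "\<exists>y :: 'i \<Rightarrow> int. (\<exists>i\<in>I. y i \<noteq> 0) \<and> (\<forall>R\<in>Rows. (\<Sum>i\<in>I. R i * y i) = 0)"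
  using assms
proof (induction I arbitrary: Rows rule: finite_induct)
  case empty
  from empty[of 1] show ?case by auto
next
  case (insert i I)
  show ?case
  proof (cases "\<forall>R\<in>Rows. R i = 0")
    case True
    have "(\<Sum>j\<in>insert i I. R j * (if j = i then 1 else 0)) = 0" if "R \<in> Rows" for R
      using True that by (intro sum.neutral) auto
    then show ?thesis by (intro exI[of _ "\<lambda>j. if j = i then 1 else 0"]) auto
  next
    case False
    then obtain R0 where R0: "R0 \<in> Rows" "R0 i \<noteq> 0" by blast
    let ?elim = "\<lambda>R j. R0 i * R j - R i * R0 j"
    have "\<exists>y. (\<exists>j\<in>I. y j \<noteq> 0) \<and> (\<forall>R\<in>?elim ` Rows. (\<Sum>j\<in>I. R j * y j) = 0)"
    proof (rule insert.IH)
      fix k :: int assume "k \<noteq> 0"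
      then have "k * R0 i \<noteq> 0" using R0 by simp
      from insert.prems[OF this] obtain Z :: "'a set" and x where
        sat: "saturated (k * R0 i) Z" and nz: "\<exists>j\<in>insert i I. x j \<notin> Z"
        and sol: "\<And>R. R \<in> Rows \<Longrightarrow> (\<Sum>j\<in>insert i I. of_int (R j) * x j) \<in> Z" by blast
      \<comment> \<open>saturation for the product gives saturation for both factors\<close>
      have cancel: "a \<in> Z" if "of_int k * a \<in> Z \<or> of_int (R0 i) * a \<in> Z" for a
      proof -
        have "of_int (R0 i) * (of_int k * a) \<in> Z \<or> of_int k * (of_int (R0 i) * a) \<in> Z"
          using that saturatedD(2)[OF sat] by blast
        then have "of_int (k * R0 i) * a \<in> Z" by (auto simp: mult_ac)
        then show ?thesis by (rule saturatedD(3)[OF sat])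
      qed
      have "saturated k Z" using sat cancel unfolding saturated_def by blast
      \<comment> \<open>otherwise the pivot row shows that the eliminated unknown is zero as well\<close>
      moreover have "\<exists>j\<in>I. x j \<notin> Z"
      proof (rule ccontr)
        assume *: "\<not> ?thesis"
        have "of_int (R0 i) * x i \<in> Z"
        proof (cases "I = {}")
          case True
          then show ?thesis using sol[OF R0(1)] by simp
        next
          case False
          have "(\<Sum>j\<in>I. of_int (R0 j) * x j) \<in> Z"
            using saturated_sum[OF sat insert.hyps(1) _ False] * by blast
          from saturated_diff[OF sat sol[OF R0(1)] this] show ?thesis using insert.hyps by simp
        qed
        then have "x i \<in> Z" using cancel by blast
        with * nz show False by blast
      qed
      moreover have "(\<Sum>j\<in>I. of_int (?elim R j) * x j) \<in> Z" if R: "R \<in> Rows" for R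
      proof -
        have "(\<Sum>j\<in>I. of_int (?elim R j) * x j) =
          of_int (R0 i) * (\<Sum>j\<in>I. of_int (R j) * x j) - of_int (R i) * (\<Sum>j\<in>I. of_int (R0 j) * x j)"
          by (simp add: sum_distrib_left sum_subtractf algebra_simps)
        also have "\<dots> = of_int (R0 i) * (\<Sum>j\<in>insert i I. of_int (R j) * x j)
            - of_int (R i) * (\<Sum>j\<in>insert i I. of_int (R0 j) * x j)"
          using insert.hyps by (simp add: algebra_simps)
        also have "\<dots> \<in> Z"
          by (intro saturated_diff[OF sat] saturatedD(2)[OF sat] sol R R0(1))
        finally show ?thesis .
      qed
      ultimately show "\<exists>(Z :: 'a set) x. saturated k Z \<and> (\<exists>j\<in>I. x j \<notin> Z) \<and>
          (\<forall>R\<in>?elim ` Rows. (\<Sum>j\<in>I. of_int (R j) * x j) \<in> Z)" by blast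
    qed
    then obtain y where y: "\<exists>j\<in>I. y j \<noteq> 0"
      "\<forall>R\<in>?elim ` Rows. (\<Sum>j\<in>I. R j * y j) = 0" by blast
    have y_elim: "(\<Sum>j\<in>I. ?elim R j * y j) = 0" if "R \<in> Rows" for R
      using bspec[OF y(2) imageI[OF that]] .
    \<comment> \<open>solve the pivot row for the eliminated unknown, scaled by the pivot to stay integral\<close>
    define z where "z = (\<lambda>j. if j = i then - (\<Sum>j\<in>I. R0 j * y j) else R0 i * y j)"
    have "(\<Sum>j\<in>insert i I. R j * z j) = 0" if "R \<in> Rows" for R
    proof -
      have "(\<Sum>j\<in>I. R j * z j) = (\<Sum>j\<in>I. R0 i * (R j * y j))"
        using insert.hyps by (intro sum.cong) (auto simp: z_def)
      then have "(\<Sum>j\<in>insert i I. R j * z j) = (\<Sum>j\<in>I. ?elim R j * y j)"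
        using insert.hyps
        by (simp add: z_def sum_distrib_left sum_subtractf algebra_simps)
      with y_elim[OF that] show ?thesis by simp
    qed
    moreover have "\<exists>j\<in>insert i I. z j \<noteq> 0"
      using y(1) R0(2) insert.hyps by (auto simp: z_def)
    ultimately show ?thesis by blast
  qed
qed

section \<open>From relations over C(w) to relations over Z[w]\<close>

definition complex_fps :: "int fps \<Rightarrow> complex fps" where
  "complex_fps F = Abs_fps (\<lambda>n. of_int (F $ n))"

lemma complex_fps_nth [simp]: "complex_fps F $ n = of_int (F $ n)"
  by (simp add: complex_fps_def)

lemma complex_fps_1: "complex_fps 1 = 1"
  by (intro fps_ext) simp

lemma complex_fps_mult: "complex_fps (F * G) = complex_fps F * complex_fps G"
  by (intro fps_ext) (simp add: fps_mult_nth)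

lemma complex_fps_power: "complex_fps (F ^ n) = complex_fps F ^ n"
  by (induction n) (simp_all add: complex_fps_1 complex_fps_mult)

lemma complex_fps_deriv: "complex_fps (fps_deriv F) = fps_deriv (complex_fps F)"
  by (intro fps_ext) simp

lemma complex_fps_funpow_deriv: "complex_fps ((fps_deriv ^^ n) F) = (fps_deriv ^^ n) (complex_fps F)"
  by (induction n) (simp_all add: complex_fps_deriv)

text \<open>
  Comparing coefficients of \<open>w^n\<close>, a relation is a linear system for the coefficients
  of the polynomials \<open>c i\<close>, whose entries are coefficients of the integer series
  \<open>u i\<close>.
\<close>

lemma integer_relation_of_complex:
  fixes u :: "nat \<Rightarrow> int fps" and c :: "nat \<Rightarrow> complex poly"
  assumes nz: "\<exists>i\<le>r. c i \<noteq> 0" and rel: "(\<Sum>i\<le>r. fps_of_poly (c i) * complex_fps (u i)) = 0"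
  shows "\<exists>C :: nat \<Rightarrow> int poly. (\<exists>i\<le>r. C i \<noteq> 0) \<and> (\<Sum>i\<le>r. fps_of_poly (C i) * u i) = 0"
proof -
  define D where "D = (\<Sum>i\<le>r. degree (c i))"
  have D: "degree (c i) \<le> D" if "i \<le> r" for i
    unfolding D_def using that by (intro member_le_sum) auto
  let ?I = "{..r} \<times> {..D}"
  define row where "row n = (\<lambda>(i, j). if j \<le> n then u i $ (n - j) else 0)" for n
  have "\<exists>y :: nat \<times> nat \<Rightarrow> int. (\<exists>ij\<in>?I. y ij \<noteq> 0) \<and> (\<forall>R\<in>range row. (\<Sum>ij\<in>?I. R ij * y ij) = 0)"
  proof (rule integer_solution)
    fix k :: int assume k: "k \<noteq> 0"
    let ?x = "\<lambda>(i, j). coeff (c i) j"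
    have "saturated k {0 :: complex}" using k by (simp add: saturated_def)
    moreover have "\<exists>ij\<in>?I. ?x ij \<notin> {0}"
    proof -
      obtain i where i: "i \<le> r" "c i \<noteq> 0" using nz by blast
      then show ?thesis using D[OF i(1)] by (intro bexI[of _ "(i, degree (c i))"]) auto
    qed
    moreover have "(\<Sum>ij\<in>?I. of_int (row n ij) * ?x ij) = 0" for n
    proof -
      have "0 = (\<Sum>i\<le>r. fps_of_poly (c i) * complex_fps (u i)) $ n" using rel by simp
      also have "\<dots> = (\<Sum>i\<le>r. \<Sum>j\<le>D. coeff (c i) j * (if j \<le> n then complex_fps (u i) $ (n - j) else 0))"
        unfolding fps_sum_nth using D by (intro sum.cong refl fps_of_poly_mult_nth) auto
      also have "\<dots> = (\<Sum>i\<le>r. \<Sum>j\<le>D. of_int (row n (i, j)) * ?x (i, j))"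
        by (intro sum.cong refl) (simp add: row_def)
      also have "\<dots> = (\<Sum>ij\<in>?I. of_int (row n ij) * ?x ij)"
        by (simp add: sum.cartesian_product case_prod_unfold)
      finally show ?thesis by simp
    qed
    ultimately show "\<exists>(Z :: complex set) x. saturated k Z \<and> (\<exists>ij\<in>?I. x ij \<notin> Z) \<and>
        (\<forall>R\<in>range row. (\<Sum>ij\<in>?I. of_int (R ij) * x ij) \<in> Z)"
      by (intro exI[of _ "{0}"] exI[of _ ?x]) auto
  qed simp
  then obtain y :: "nat \<times> nat \<Rightarrow> int" where y: "\<exists>ij\<in>?I. y ij \<noteq> 0"
    "\<And>n. (\<Sum>ij\<in>?I. row n ij * y ij) = 0" by blast
  define C where "C i = (\<Sum>j\<le>D. monom (y (i, j)) j)" for i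
  have coeff_C: "coeff (C i) j = (if j \<le> D then y (i, j) else 0)" for i j
    by (simp add: C_def coeff_sum)
  have "\<exists>i\<le>r. C i \<noteq> 0"
  proof -
    obtain i j where "i \<le> r" "j \<le> D" "y (i, j) \<noteq> 0" using y(1) by auto
    then have "coeff (C i) j \<noteq> 0" by (simp add: coeff_C)
    with \<open>i \<le> r\<close> show ?thesis by force
  qed
  moreover have "(\<Sum>i\<le>r. fps_of_poly (C i) * u i) $ n = 0" for n
  proof -
    have "degree (C i) \<le> D" for i by (rule degree_le) (simp add: coeff_C)
    then have "(fps_of_poly (C i) * u i) $ n = (\<Sum>j\<le>D. row n (i, j) * y (i, j))" for i
      by (subst fps_of_poly_mult_nth[of _ D]) (auto intro!: sum.cong simp: coeff_C row_def)
    then have "(\<Sum>i\<le>r. fps_of_poly (C i) * u i) $ n = (\<Sum>i\<le>r. \<Sum>j\<le>D. row n (i, j) * y (i, j))"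
      by (simp add: fps_sum_nth)
    also have "\<dots> = (\<Sum>ij\<in>?I. row n ij * y ij)"
      by (simp add: sum.cartesian_product case_prod_unfold)
    finally show ?thesis using y(2) by simp
  qed
  then have "(\<Sum>i\<le>r. fps_of_poly (C i) * u i) = 0" by (intro fps_ext) simp
  ultimately show ?thesis by blast
qed

lemma fps_to_fls_sum: "fps_to_fls (\<Sum>i\<in>I. F i) = (\<Sum>i\<in>I. fps_to_fls (F i))"
  by (induction I rule: infinite_finite_induct) simp_all

lemma polynomial_relation_of_rational:
  fixes F :: "nat \<Rightarrow> complex fps"
  assumes rat: "\<forall>i\<le>r. c i \<in> rational_fls" and nz: "\<exists>i\<le>r. c i \<noteq> 0"
    and rel: "(\<Sum>i\<le>r. c i * fps_to_fls (F i)) = 0"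
  shows "\<exists>c' :: nat \<Rightarrow> complex poly. (\<exists>i\<le>r. c' i \<noteq> 0) \<and> (\<Sum>i\<le>r. fps_of_poly (c' i) * F i) = 0"
proof -
  let ?\<iota> = "\<lambda>p :: complex poly. fps_to_fls (fps_of_poly p)"
  have "\<forall>i. \<exists>p q. i \<le> r \<longrightarrow> q \<noteq> 0 \<and> c i = ?\<iota> p / ?\<iota> q" using rat unfolding rational_fls_def by blast
  then obtain a b where ab: "\<And>i. i \<le> r \<Longrightarrow> b i \<noteq> 0 \<and> c i = ?\<iota> (a i) / ?\<iota> (b i)" by metis
  have \<iota>0: "?\<iota> p = 0 \<longleftrightarrow> p = 0" for p by simp
  define c' where "c' i = a i * (\<Prod>j\<in>{..r} - {i}. b j)" for i
  define B where "B = ?\<iota> (\<Prod>j\<in>{..r}. b j)"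
  have c': "?\<iota> (c' i) = B * c i" if "i \<le> r" for i
  proof -
    have "(\<Prod>j\<in>{..r}. b j) = b i * (\<Prod>j\<in>{..r} - {i}. b j)" using that by (intro prod.remove) auto
    then have "B = ?\<iota> (b i) * ?\<iota> (\<Prod>j\<in>{..r} - {i}. b j)"
      by (simp add: B_def fps_of_poly_mult fls_times_fps_to_fls)
    then show ?thesis using ab[OF that]
      by (simp add: c'_def fps_of_poly_mult fls_times_fps_to_fls)
  qed
  have "B \<noteq> 0" using ab by (simp add: B_def)
  then have "\<exists>i\<le>r. c' i \<noteq> 0" using nz c' by (metis \<iota>0 mult_eq_0_iff)
  moreover have "fps_to_fls (\<Sum>i\<le>r. fps_of_poly (c' i) * F i) = B * (\<Sum>i\<le>r. c i * fps_to_fls (F i))"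
    by (simp add: fps_to_fls_sum fls_times_fps_to_fls c' sum_distrib_left mult.assoc)
  then have "(\<Sum>i\<le>r. fps_of_poly (c' i) * F i) = 0" using rel by simp
  ultimately show ?thesis by blast
qed

section \<open>Logarithmic derivatives modulo a prime\<close>

text \<open>
  If \<open>h' = -g h\<close> and \<open>Q g = N\<close>, then
  \<open>Q^j h^(j) = riccati Q N j * h\<close>. The zeros of \<open>Q\<close> are poles of
  \<open>g\<close>, and there only the last two terms of the recursion survive.
\<close>

primrec riccati :: "int poly \<Rightarrow> int poly \<Rightarrow> nat \<Rightarrow> int poly" where
  "riccati Q N 0 = 1"
| "riccati Q N (Suc j) =
     Q * pderiv (riccati Q N j) - of_nat j * pderiv Q * riccati Q N j - N * riccati Q N j"

lemma riccati_cong: "Q dvd riccati Q N j - (-1) ^ j * (\<Prod>i<j. N + of_nat i * pderiv Q)"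
proof (induction j)
  case (Suc j)
  let ?T = "N + of_nat j * pderiv Q" and ?D = "riccati Q N j - (-1) ^ j * (\<Prod>i<j. N + of_nat i * pderiv Q)"
  have "riccati Q N (Suc j) - (-1) ^ Suc j * (\<Prod>i<Suc j. N + of_nat i * pderiv Q) =
      Q * pderiv (riccati Q N j) - ?T * ?D"
    by (simp add: algebra_simps)
  also have "Q dvd \<dots>" by (rule dvd_diff[OF dvd_triv_left dvd_mult[OF Suc.IH]])
  finally show ?case .
qed simp

lemma riccati_deriv:
  fixes h g :: "int fps"
  assumes h: "fps_deriv h = - g * h" and QN: "of_nat p dvd fps_of_poly Q * g - fps_of_poly N"
  shows "of_nat p dvd fps_of_poly Q ^ j * (fps_deriv ^^ j) h - fps_of_poly (riccati Q N j) * h"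
proof (induction j)
  case (Suc j)
  let ?Q = "fps_of_poly Q" and ?S = "fps_of_poly (riccati Q N j)" and ?H = "(fps_deriv ^^ j) h"
  let ?D = "?Q ^ j * ?H - ?S * h"
  have dQ: "?Q * fps_deriv (?Q ^ j) = of_nat j * fps_deriv ?Q * ?Q ^ j"
  proof (cases j)
    case (Suc k)
    have "fps_deriv (?Q ^ Suc k) = of_nat (Suc k) * fps_deriv ?Q * ?Q ^ k"
      by (simp only: fps_deriv_power' diff_Suc_1)
    then show ?thesis unfolding Suc power_Suc by (simp only: mult_ac)
  qed simp
  have S: "fps_of_poly (riccati Q N (Suc j)) =
      ?Q * fps_deriv ?S - of_nat j * fps_deriv ?Q * ?S - fps_of_poly N * ?S"
    by (simp add: fps_of_poly_diff fps_of_poly_mult fps_of_poly_pderiv fps_of_poly_of_nat)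
  have "?Q * fps_deriv ?D = ?Q * fps_deriv (?Q ^ j) * ?H + ?Q * ?Q ^ j * fps_deriv ?H
      - ?Q * fps_deriv ?S * h + ?S * (?Q * g) * h"
    by (simp add: h algebra_simps)
  then have "?Q ^ Suc j * (fps_deriv ^^ Suc j) h - fps_of_poly (riccati Q N (Suc j)) * h =
      ?Q * fps_deriv ?D - of_nat j * fps_deriv ?Q * ?D - ?S * h * (?Q * g - fps_of_poly N)"
    unfolding S dQ by (simp add: algebra_simps)
  also have "of_nat p dvd \<dots>"
    by (rule dvd_diff[OF dvd_diff[OF dvd_mult[OF of_nat_dvd_fps_deriv[OF Suc.IH]]
        dvd_mult[OF Suc.IH]] dvd_mult[OF QN]])
  finally show ?case .
qed simp

text \<open>
  Multiplying the relation by \<open>Q^s / h\<close> clears the denominators; all terms except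
  the last keep a factor \<open>Q\<close>.
\<close>

lemma leading_term_mod:
  fixes u :: "nat \<Rightarrow> int fps" and C S :: "nat \<Rightarrow> int poly"
  assumes rel: "(\<Sum>i\<le>s. fps_of_poly (C i) * u i) = 0" and inv: "f * h = 1"
    and u: "\<And>i. of_nat p dvd fps_of_poly Q ^ i * u i - fps_of_poly (S i) * h"
  shows "dvd_mod p Q (C s * S s)"
proof -
  let ?E = "\<Sum>i\<le>s. C i * Q ^ (s - i) * S i"
  have Qs: "fps_of_poly Q ^ s = fps_of_poly Q ^ (s - i) * fps_of_poly Q ^ i" if "i \<le> s" for i
    using that by (metis power_add le_add_diff_inverse2)
  have "fps_of_poly Q ^ s * (\<Sum>i\<le>s. fps_of_poly (C i) * u i) =
      (\<Sum>i\<le>s. fps_of_poly (C i * Q ^ (s - i)) * (fps_of_poly Q ^ i * u i))"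
    unfolding sum_distrib_left
  proof (intro sum.cong refl)
    fix i assume "i \<in> {..s}"
    then show "fps_of_poly Q ^ s * (fps_of_poly (C i) * u i) =
        fps_of_poly (C i * Q ^ (s - i)) * (fps_of_poly Q ^ i * u i)"
      using Qs[of i] by (simp only: fps_of_poly_mult fps_of_poly_power mult_ac atMost_iff)
  qed
  then have zero: "(\<Sum>i\<le>s. fps_of_poly (C i * Q ^ (s - i)) * (fps_of_poly Q ^ i * u i)) = 0"
    using rel by simp
  let ?X = "\<Sum>i\<le>s. fps_of_poly (C i * Q ^ (s - i)) * (fps_of_poly Q ^ i * u i - fps_of_poly (S i) * h)"
  have "?X = (\<Sum>i\<le>s. fps_of_poly (C i * Q ^ (s - i)) * (fps_of_poly Q ^ i * u i)) -
      (\<Sum>i\<le>s. fps_of_poly (C i * Q ^ (s - i) * S i) * h)"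
    unfolding sum_subtractf[symmetric]
    by (intro sum.cong refl) (simp only: fps_of_poly_mult right_diff_distrib mult.assoc)
  also have "\<dots> = - fps_of_poly ?E * h"
    unfolding zero fps_of_poly_sum sum_distrib_right[symmetric] by simp
  finally have X: "?X = - fps_of_poly ?E * h" .
  have "- f * (- e * h) = e" for e using inv by algebra
  then have "fps_of_poly ?E = - f * ?X" by (simp only: X)
  also have "of_nat p dvd \<dots>" by (intro dvd_mult dvd_sum u)
  finally have E: "of_nat p dvd ?E" by (simp add: of_nat_dvd_fps_of_poly)
  have split: "?E = (\<Sum>i<s. C i * Q ^ (s - i) * S i) + C s * S s"
    by (simp add: lessThan_Suc_atMost[symmetric])
  have "Q dvd (\<Sum>i<s. C i * Q ^ (s - i) * S i)"
    by (intro dvd_sum dvd_mult dvd_mult2 dvd_power) auto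
  from dvd_mod_diff[OF dvd_mod_of_modulus[OF E] dvd_imp_dvd_mod[OF this]]
  show ?thesis unfolding split by simp
qed

text \<open>
  The power series form of \<open>poly_log_derivative_mod_p\<close>. It passes to a monic multiple
  \<open>P1\<close> of \<open>P\<close> modulo \<open>p\<close>, and cancels \<open>P\<close>,
  which is a unit among the power series.
\<close>

lemma log_derivative_mod_p:
  fixes P :: "int poly" and g :: "int fps"
  assumes p: "prime p" and P0: "coeff P 0 = 1" and degP: "degree P < p"
    and Pg: "of_nat p dvd fps_of_poly P * g - fps_of_poly (pderiv P)"
  obtains Q N where "lead_coeff Q = 1" "degree N \<le> degree Q" "of_nat p dvd fps_of_poly Q * g - fps_of_poly N"
    "pole_test p Q N"
proof -
  have "\<not> of_nat p dvd P" using P0 prime_int_gt_1[OF p] unfolding of_nat_dvd_poly_iff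
    by (metis zdvd_not_zless zero_less_one)
  from make_monic[OF p this] obtain u v P1 where P1: "lead_coeff P1 = 1" "degree P1 \<le> degree P"
    "of_nat p dvd of_int u * P - P1" "int p dvd u * v - 1" .
  from poly_log_derivative_mod_p[OF p P1(1) le_less_trans[OF P1(2) degP]]
  obtain Q N where QN: "lead_coeff Q = 1" "degree N \<le> degree Q" "of_nat p dvd Q * pderiv P1 - N * P1"
    and bound: "pole_test p Q N" .
  obtain z where "of_int u * P - P1 = of_nat p * z" using P1(3) by (elim dvdE)
  then have z: "P1 = of_int u * P - of_nat p * z" by algebra
  have dP1: "pderiv P1 = of_int u * pderiv P - of_nat p * pderiv z"
    by (simp add: z pderiv_diff pderiv_mult of_int_poly of_nat_poly pderiv_smult)
  have "of_int u * (Q * pderiv P - N * P) = (Q * pderiv P1 - N * P1) + of_nat p * (Q * pderiv z - N * z)"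
    unfolding dP1 unfolding z by (simp add: algebra_simps)
  also have "of_nat p dvd \<dots>" using QN(3) by simp
  finally have "of_nat p dvd fps_of_poly (of_int u * (Q * pderiv P - N * P))"
    by (simp add: of_nat_dvd_fps_of_poly)
  moreover define R where "R = fps_right_inverse (fps_of_poly P) 1"
  have R: "fps_of_poly P * R = 1" unfolding R_def using P0 by (intro fps_right_inverse) simp
  let ?X = "fps_of_poly Q * g - fps_of_poly N"
  have "of_int (u * v) * ?X = of_int v * R * (of_int u * fps_of_poly Q * (fps_of_poly P * g - fps_of_poly (pderiv P))
      + fps_of_poly (of_int u * (Q * pderiv P - N * P)))"
  proof -
    have "of_int v * R * (of_int u * fps_of_poly Q * (fps_of_poly P * g - fps_of_poly (pderiv P))
      + fps_of_poly (of_int u * (Q * pderiv P - N * P))) = of_int (u * v) * (fps_of_poly P * R) * ?X"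
      by (simp add: fps_of_poly_mult fps_of_poly_diff fps_of_poly_of_int algebra_simps)
    then show ?thesis unfolding R mult_1_right by (rule sym)
  qed
  ultimately have "of_nat p dvd of_int (u * v) * ?X" using Pg by (metis dvd_add dvd_mult)
  moreover have "of_nat p dvd (of_int (u * v - 1) :: int fps)"
    using P1(4) by (elim dvdE) (simp only: of_int_mult of_int_of_nat_eq dvd_triv_left)
  then have "of_nat p dvd of_int (u * v - 1) * ?X" by (rule dvd_mult2)
  ultimately have "of_nat p dvd of_int (u * v) * ?X - of_int (u * v - 1) * ?X" by (rule dvd_diff)
  then have "of_nat p dvd ?X" by (simp add: algebra_simps)
  then show thesis using that QN(1,2) bound by blast
qed

text \<open>
  For the second kind of relation, \<open>Q^i g^i = N^i\<close> takes the place of the Riccati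
  polynomials.
\<close>

lemma relation_imp_dvd_mod:
  fixes f g h :: "int fps"
  assumes inv: "f * h = 1" and dh: "fps_deriv h = - g * h"
    and QN: "of_nat p dvd fps_of_poly Q * g - fps_of_poly N"
    and rel: "(\<Sum>i\<le>s. fps_of_poly (C i) * (fps_deriv ^^ i) h) = 0 \<or>
              (\<Sum>i\<le>s. fps_of_poly (C i) * g ^ i) = 0"
  obtains e :: "nat \<Rightarrow> nat" where "\<forall>i<s. e i < s"
    "dvd_mod p Q (C s * (\<Prod>i<s. N + of_nat (e i) * pderiv Q))"
  using rel
proof
  let ?T = "\<Prod>i<s. N + of_nat i * pderiv Q"
  assume "(\<Sum>i\<le>s. fps_of_poly (C i) * (fps_deriv ^^ i) h) = 0"
  then have "dvd_mod p Q (C s * riccati Q N s)"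
    by (rule leading_term_mod[OF _ inv riccati_deriv[OF dh QN]])
  moreover have "dvd_mod p Q (C s * (riccati Q N s - (-1) ^ s * ?T))"
    by (intro dvd_mod_mult dvd_imp_dvd_mod riccati_cong)
  ultimately have "dvd_mod p Q (C s * riccati Q N s - C s * (riccati Q N s - (-1) ^ s * ?T))"
    by (rule dvd_mod_diff)
  also have "C s * riccati Q N s - C s * (riccati Q N s - (-1) ^ s * ?T) = C s * ((-1) ^ s * ?T)"
    by (simp only: right_diff_distrib diff_diff_eq2 add_diff_cancel_left')
  finally have "dvd_mod p Q ((-1) ^ s * (C s * ((-1) ^ s * ?T)))"
    by (rule dvd_mod_mult)
  also have "(-1) ^ s * (C s * ((-1) ^ s * ?T)) = ((-1) ^ s * (-1) ^ s) * (C s * ?T)"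
    by (simp only: mult_ac)
  also have "(-1) ^ s * (-1) ^ s = (1 :: int poly)" by (simp flip: power_mult_distrib)
  finally have "dvd_mod p Q (C s * ?T)" by simp
  then show thesis using that[of "\<lambda>i. i"] by simp
next
  assume rel': "(\<Sum>i\<le>s. fps_of_poly (C i) * g ^ i) = 0"
  have "of_nat p dvd fps_of_poly Q ^ i * g ^ i - fps_of_poly (N ^ i) * 1" for i
  proof -
    have "fps_of_poly Q * g - fps_of_poly N dvd (fps_of_poly Q * g) ^ i - fps_of_poly N ^ i"
      by (simp only: power_diff_sumr2 dvd_triv_left)
    with QN have "of_nat p dvd (fps_of_poly Q * g) ^ i - fps_of_poly N ^ i" by (rule dvd_trans)
    then show ?thesis by (simp only: power_mult_distrib fps_of_poly_power mult_1_right)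
  qed
  then have "dvd_mod p Q (C s * N ^ s)" by (rule leading_term_mod[OF rel' mult_1_left])
  then show thesis using that[of "\<lambda>_. 0"] by (cases "s = 0") simp_all
qed

text \<open>
  Modulo each large prime \<open>p\<close>, \<open>g\<close> is a quotient of polynomials of
  degree at most \<open>B = degree (C s) + 1\<close>. That \<open>Q g\<close> is a
  polynomial of degree at most \<open>B\<close>, for some \<open>Q \<noteq> 0\<close> of degree
  at most \<open>B\<close>, is the solvability of a linear system for the coefficients of
  \<open>Q\<close> with one integer equation for every \<open>n > B\<close>. So it is solvable
  over the integers.
\<close>

lemma log_derivative_rational:
  fixes f g h :: "int fps"
  assumes inv: "f * h = 1" and df: "fps_deriv f = g * f" and dh: "fps_deriv h = - g * h"
    and lucas: "\<And>p. prime p \<Longrightarrow> \<exists>P. coeff P 0 = 1 \<and> degree P < p \<and>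
       of_nat p dvd fps_of_poly P * fps_deriv f - fps_of_poly (pderiv P) * f"
    and C: "C s \<noteq> 0"
    and rel: "(\<Sum>i\<le>s. fps_of_poly (C i) * (fps_deriv ^^ i) h) = 0 \<or>
              (\<Sum>i\<le>s. fps_of_poly (C i) * g ^ i) = 0"
  shows "\<exists>Q N :: int poly. Q \<noteq> 0 \<and> fps_of_poly Q * fps_deriv f = fps_of_poly N * f"
proof -
  define B where "B = degree (C s) + 1"
  define row where "row n i = (if i \<le> n then g $ (n - i) else 0)" for n i
  have "\<exists>y :: nat \<Rightarrow> int. (\<exists>i\<in>{..B}. y i \<noteq> 0) \<and> (\<forall>R\<in>row ` {B<..}. (\<Sum>i\<in>{..B}. R i * y i) = 0)"
  proof (rule integer_solution)
    fix k :: int assume k: "k \<noteq> 0"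
    \<comment> \<open>\<open>p\<close> divides neither \<open>k\<close> nor the leading coefficient of \<open>C s\<close>, and \<open>2 s \<le> p\<close> as the pole test requires\<close>
    obtain p where p: "prime p" "nat \<bar>k\<bar> + nat \<bar>lead_coeff (C s)\<bar> + 2 * s < p"
      using bigger_prime by blast
    have small: "\<not> int p dvd a" if "a \<noteq> 0" "nat \<bar>a\<bar> < p" for a
      using that zdvd_imp_le[of "int p" "\<bar>a\<bar>"] by auto
    obtain P where P: "coeff P 0 = 1" "degree P < p"
      "of_nat p dvd fps_of_poly P * fps_deriv f - fps_of_poly (pderiv P) * f" using lucas[OF p(1)] by blast
    have "of_nat p dvd h * (fps_of_poly P * fps_deriv f - fps_of_poly (pderiv P) * f)"
      using P(3) by (rule dvd_mult)
    also have "h * (fps_of_poly P * fps_deriv f - fps_of_poly (pderiv P) * f) =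
        fps_of_poly P * g - fps_of_poly (pderiv P)"
      unfolding df using inv by algebra
    finally obtain Q N where QN: "lead_coeff Q = 1" "degree N \<le> degree Q"
      "of_nat p dvd fps_of_poly Q * g - fps_of_poly N" "pole_test p Q N"
      using log_derivative_mod_p[OF p(1) P(1,2)] by blast
    obtain e where e: "\<forall>i<s. e i < s"
      "dvd_mod p Q (C s * (\<Prod>i<s. N + of_nat (e i) * pderiv Q))"
      using relation_imp_dvd_mod[OF inv dh QN(3) rel] .
    have "\<not> of_nat p dvd C s"
      using small[of "lead_coeff (C s)"] C p(2) unfolding of_nat_dvd_poly_iff by fastforce
    moreover have "2 * s \<le> p" using p(2) by simp
    ultimately have "degree Q \<le> B"
      using QN(4) e unfolding pole_test_def[OF p(1)] B_def by blast
    then have deg: "degree Q \<le> B" "degree N \<le> B" using QN(2) by simp_all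
    let ?Z = "{a. int p dvd a}"
    have "saturated k ?Z"
      unfolding saturated_def using p small[of k] k
      by (auto simp: prime_dvd_mult_iff)
    moreover have "coeff Q (degree Q) \<notin> ?Z" using QN(1) prime_int_gt_1[OF p(1)] by simp
    then have "\<exists>i\<in>{..B}. coeff Q i \<notin> ?Z" using deg(1) by blast
    moreover have "(\<Sum>i\<in>{..B}. of_int (row n i) * coeff Q i) \<in> ?Z" if "n > B" for n
    proof -
      have "(fps_of_poly Q * g - fps_of_poly N) $ n = (\<Sum>i\<le>B. row n i * coeff Q i)"
        using that deg coeff_eq_0[of N n]
        by (auto simp: fps_of_poly_mult_nth[OF deg(1)] row_def intro!: sum.cong)
      moreover have "int p dvd (fps_of_poly Q * g - fps_of_poly N) $ n"
        using QN(3) unfolding of_nat_dvd_fps_iff by blast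
      ultimately show ?thesis by simp
    qed
    ultimately show "\<exists>(Z :: int set) x. saturated k Z \<and> (\<exists>i\<in>{..B}. x i \<notin> Z) \<and>
        (\<forall>R\<in>row ` {B<..}. (\<Sum>i\<in>{..B}. of_int (R i) * x i) \<in> Z)"
      by (intro exI[of _ ?Z] exI[of _ "coeff Q"]) auto
  qed simp
  then obtain y :: "nat \<Rightarrow> int" where y: "\<exists>i\<le>B. y i \<noteq> 0"
    and sol: "\<And>n. n > B \<Longrightarrow> (\<Sum>i\<le>B. row n i * y i) = 0" by auto
  define Q where "Q = (\<Sum>i\<le>B. monom (y i) i)"
  have coeff_Q: "coeff Q i = (if i \<le> B then y i else 0)" for i
    by (simp add: Q_def coeff_sum)
  have "degree Q \<le> B" by (rule degree_le) (simp add: coeff_Q)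
  define N where "N = (\<Sum>i\<le>B. monom ((fps_of_poly Q * g) $ i) i)"
  have "fps_of_poly Q * g = fps_of_poly N"
  proof (rule fps_ext)
    fix n
    show "(fps_of_poly Q * g) $ n = fps_of_poly N $ n"
    proof (cases "n \<le> B")
      case False
      have "(fps_of_poly Q * g) $ n = (\<Sum>i\<le>B. row n i * y i)"
        by (auto simp: fps_of_poly_mult_nth[OF \<open>degree Q \<le> B\<close>] row_def coeff_Q intro!: sum.cong)
      with False sol show ?thesis by (simp add: N_def coeff_sum)
    qed (simp add: N_def coeff_sum)
  qed
  then have "fps_of_poly Q * fps_deriv f = fps_of_poly N * f"
    unfolding df by (simp add: mult.assoc[symmetric])
  moreover have "Q \<noteq> 0" using y coeff_Q by (metis coeff_0)
  ultimately show ?thesis by blast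
qed

section \<open>Consequences of Lucas congruences\<close>

definition truncation :: "nat \<Rightarrow> (nat \<Rightarrow> int) \<Rightarrow> int poly" where
  "truncation p a = (\<Sum>i<p. monom (a i) i)"

lemma coeff_truncation: "coeff (truncation p a) i = (if i < p then a i else 0)"
  by (simp add: truncation_def coeff_sum)

text \<open>
  The congruences say that \<open>f = P * E\<close> modulo \<open>p\<close> with
  \<open>E = f(w^p)\<close>, and the derivative of \<open>E\<close> is divisible by
  \<open>p\<close>.
\<close>

lemma lucas_log_derivative:
  fixes a :: "nat \<Rightarrow> int"
  assumes p: "prime p"
    and lucas: "\<And>n m. m < p \<Longrightarrow> int p dvd a (n * p + m) - a n * a m"
  defines "f \<equiv> Abs_fps a" and "P \<equiv> truncation p a"
  shows "degree P < p" "of_nat p dvd fps_of_poly P * fps_deriv f - fps_of_poly (pderiv P) * f"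
proof -
  have p0: "p > 0" using p by (rule prime_gt_0_nat)
  have "degree P \<le> p - 1" unfolding P_def by (rule degree_le) (auto simp: coeff_truncation)
  then show deg: "degree P < p" using p0 by linarith
  define E where "E = Abs_fps (\<lambda>n. if p dvd n then a (n div p) else 0)"
  have "(fps_of_poly P * E) $ n = a (n div p) * a (n mod p)" for n
  proof -
    have "(fps_of_poly P * E) $ n = (\<Sum>j\<le>p - 1. coeff P j * (if j \<le> n then E $ (n - j) else 0))"
      by (rule fps_of_poly_mult_nth) fact
    also have "\<dots> = (\<Sum>j\<in>{n mod p}. coeff P j * (if j \<le> n then E $ (n - j) else 0))"
    proof (rule sum.mono_neutral_right)
      show "\<forall>j\<in>{..p - 1} - {n mod p}. coeff P j * (if j \<le> n then E $ (n - j) else 0) = 0"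
      proof
        fix j assume j: "j \<in> {..p - 1} - {n mod p}"
        have "\<not> p dvd n - j" if "j \<le> n"
        proof
          assume "p dvd n - j"
          then have "n mod p = j mod p" using that by (metis mod_eq_dvd_iff_nat)
          with j p0 show False by auto
        qed
        then show "coeff P j * (if j \<le> n then E $ (n - j) else 0) = 0" by (simp add: E_def)
      qed
    qed (use p0 in \<open>auto simp: less_Suc_eq_le[symmetric]\<close>)
    also have "\<dots> = a (n div p) * a (n mod p)"
      using p0 by (simp add: E_def P_def coeff_truncation minus_mod_eq_mult_div)
    finally show ?thesis .
  qed
  moreover have "int p dvd a n - a (n div p) * a (n mod p)" for n
    using lucas[of "n mod p" "n div p"] p0 by simp
  ultimately have fE: "of_nat p dvd f - fps_of_poly P * E"
    by (simp add: of_nat_dvd_fps_iff f_def)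
  have dE: "of_nat p dvd fps_deriv E"
    unfolding of_nat_dvd_fps_iff
  proof
    fix n show "int p dvd fps_deriv E $ n"
      by (cases "p dvd Suc n") (auto simp: E_def simp flip: of_nat_Suc)
  qed
  let ?P = "fps_of_poly P" and ?D = "f - fps_of_poly P * E"
  have "?P * fps_deriv f - fps_of_poly (pderiv P) * f =
      ?P * fps_deriv ?D + ?P * ?P * fps_deriv E - fps_deriv ?P * ?D"
    by (simp add: fps_of_poly_pderiv algebra_simps)
  also have "of_nat p dvd \<dots>"
    by (rule dvd_diff[OF dvd_add[OF dvd_mult[OF of_nat_dvd_fps_deriv[OF fE]] dvd_mult[OF dE]] dvd_mult[OF fE]])
  finally show "of_nat p dvd ?P * fps_deriv f - fps_of_poly (pderiv P) * f" .
qed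

lemma complex_fps_quotient:
  assumes "f * h = 1"
  shows "F / complex_fps f = F * complex_fps h"
proof -
  have "complex_fps f * complex_fps h = 1" using assms by (simp flip: complex_fps_mult add: complex_fps_1)
  moreover from this have "complex_fps f $ 0 \<noteq> 0" by (metis fps_mult_nth_0 fps_one_nth mult_zero_left zero_neq_one)
  ultimately show ?thesis by (metis fps_divide_unit fps_inverse_unique mult.commute)
qed

lemma reciprocal_not_holonomic:
  fixes a :: "nat \<Rightarrow> int"
  assumes a0: "a 0 = 1"
    and lucas: "\<And>p n m. prime p \<Longrightarrow> m < p \<Longrightarrow> int p dvd a (n * p + m) - a n * a m"
    and irrational: "\<And>Q N :: int poly. Q \<noteq> 0 \<Longrightarrow>
      fps_of_poly Q * fps_deriv (Abs_fps a) \<noteq> fps_of_poly N * Abs_fps a"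
  defines "F \<equiv> Abs_fps (\<lambda>n. of_int (a n)) :: complex fps"
  shows "\<not> algebraic_fps (fps_deriv F / F)" "\<not> holonomic (1 / F)"
proof -
  define f where "f = Abs_fps a"
  define h where "h = fps_right_inverse f 1"
  define g where "g = fps_deriv f * h"
  have inv: "f * h = 1" unfolding h_def by (intro fps_right_inverse) (simp add: f_def a0)
  have df: "fps_deriv f = g * f" using inv by (simp add: g_def mult_ac)
  have "fps_deriv f * h + f * fps_deriv h = 0"
    using arg_cong[OF inv, of fps_deriv] by (simp add: add.commute)
  then have dh: "fps_deriv h = - g * h" using inv unfolding g_def by algebra
  have P: "\<exists>P. coeff P 0 = 1 \<and> degree P < p \<and>
       of_nat p dvd fps_of_poly P * fps_deriv f - fps_of_poly (pderiv P) * f" if "prime p" for p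
    using lucas_log_derivative[of p a] lucas that prime_gt_0_nat[OF that] a0
    by (intro exI[of _ "truncation p a"]) (simp add: f_def coeff_truncation)
  have no_rel: False if nz: "\<exists>i\<le>r. C i \<noteq> 0" and rel: "(\<Sum>i\<le>r. fps_of_poly (C i) * (fps_deriv ^^ i) h) = 0 \<or>
              (\<Sum>i\<le>r. fps_of_poly (C i) * g ^ i) = 0" for r :: nat and C :: "nat \<Rightarrow> int poly"
  proof -
    \<comment> \<open>the order of the relation, after dropping zero coefficients at the top\<close>
    define s where "s = Max {i. i \<le> r \<and> C i \<noteq> 0}"
    have fin: "finite {i. i \<le> r \<and> C i \<noteq> 0}" by simp
    have s: "s \<le> r" "C s \<noteq> 0" using Max_in[OF fin] nz by (auto simp: s_def)
    have "C i = 0" if "i \<le> r" "i > s" for i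
      using Max_ge[OF fin, of i] that by (fastforce simp: s_def)
    then have "(\<Sum>i\<le>r. fps_of_poly (C i) * u i) = (\<Sum>i\<le>s. fps_of_poly (C i) * u i)" for u
      using s(1) by (intro sum.mono_neutral_right) auto
    with rel have "(\<Sum>i\<le>s. fps_of_poly (C i) * (fps_deriv ^^ i) h) = 0 \<or>
              (\<Sum>i\<le>s. fps_of_poly (C i) * g ^ i) = 0" by simp
    from log_derivative_rational[OF inv df dh P s(2) this] irrational show False
      unfolding f_def by blast
  qed
  have descend: False if "\<forall>i\<le>r. c i \<in> rational_fls" "\<exists>i\<le>r. c i \<noteq> 0"
    "(\<Sum>i\<le>r. c i * fps_to_fls (complex_fps (u i))) = 0" "u = (\<lambda>i. (fps_deriv ^^ i) h) \<or> u = (\<lambda>i. g ^ i)" for r c u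
  proof -
    from polynomial_relation_of_rational[OF that(1-3)] obtain c' :: "nat \<Rightarrow> complex poly" where
      "\<exists>i\<le>r. c' i \<noteq> 0" "(\<Sum>i\<le>r. fps_of_poly (c' i) * complex_fps (u i)) = 0" by blast
    from integer_relation_of_complex[OF this] obtain C :: "nat \<Rightarrow> int poly" where
      C: "\<exists>i\<le>r. C i \<noteq> 0" "(\<Sum>i\<le>r. fps_of_poly (C i) * u i) = 0" by blast
    show False using that(4) C(2) no_rel[OF C(1)] by auto
  qed
  have F: "F = complex_fps f" by (intro fps_ext) (simp add: F_def f_def)
  have "fps_deriv F / F = complex_fps g"
    unfolding F complex_fps_quotient[OF inv] by (simp add: g_def complex_fps_mult complex_fps_deriv)
  then show "\<not> algebraic_fps (fps_deriv F / F)"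
    unfolding algebraic_fps_def
  proof (intro notI, elim exE conjE)
    fix A :: "complex fls poly"
    assume A: "A \<noteq> 0" "\<forall>i. coeff A i \<in> rational_fls" "poly A (fps_to_fls (fps_deriv F / F)) = 0"
      and g: "fps_deriv F / F = complex_fps g"
    have "(\<Sum>i\<le>degree A. coeff A i * fps_to_fls (complex_fps (g ^ i))) = 0"
      using A(3) unfolding g poly_altdef by (simp add: complex_fps_power fps_to_fls_power)
    moreover have "\<exists>i\<le>degree A. coeff A i \<noteq> 0" using A(1) by (intro exI[of _ "degree A"]) simp
    ultimately show False using descend[of "degree A" "coeff A"] A(2) by blast
  qed
  have F_inv: "1 / F = complex_fps h" unfolding F complex_fps_quotient[OF inv] by simp
  show "\<not> holonomic (1 / F)"
  proof
    assume "holonomic (1 / F)"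
    then obtain r :: nat and c :: "nat \<Rightarrow> complex fls" where
      "\<forall>i\<le>r. c i \<in> rational_fls" "\<exists>i\<le>r. c i \<noteq> 0"
      "(\<Sum>i\<le>r. c i * fps_to_fls ((fps_deriv ^^ i) (1 / F))) = 0"
      unfolding holonomic_def by blast
    then show False using descend[of r c "\<lambda>i. (fps_deriv ^^ i) h"]
      by (simp add: complex_fps_funpow_deriv F_inv)
  qed
qed

section \<open>Lucas congruences\<close>

lemma prime_dvd_choose_middle:
  assumes "prime p" "0 < k" "k < p" shows "p dvd p choose k"
  using dvd_choose_prime[of k p] assms by auto

text \<open>
  The coefficient form of \<open>(1 + X)^(p + N) = (1 + X^p) (1 + X)^N\<close> modulo
  \<open>p\<close>.
\<close>

lemma choose_add_prime:
  assumes p: "prime p"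
  shows "int p dvd int ((p + N) choose K) - (int (N choose K) + (if p \<le> K then int (N choose (K - p)) else 0))"
proof -
  have p1: "p > 0" using p by (rule prime_gt_0_nat)
  let ?t = "\<lambda>j. int ((p choose j) * (N choose (K - j)))"
  have "int ((p + N) choose K) = (\<Sum>j\<le>K. ?t j)" by (simp only: vandermonde[symmetric] of_nat_sum)
  also have "\<dots> = (\<Sum>j\<in>{..K} \<inter> {0, p}. ?t j) + (\<Sum>j\<in>{..K} - {0, p}. ?t j)"
    by (subst sum.Int_Diff[of _ _ "{0, p}"]) auto
  also have "(\<Sum>j\<in>{..K} \<inter> {0, p}. ?t j) = int (N choose K) + (if p \<le> K then int (N choose (K - p)) else 0)"
    using p1 by (auto simp: Int_insert_right)
  finally have "int ((p + N) choose K) - (int (N choose K) + (if p \<le> K then int (N choose (K - p)) else 0)) =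
    (\<Sum>j\<in>{..K} - {0, p}. ?t j)" by simp
  also have "int p dvd \<dots>"
  proof (rule dvd_sum)
    fix j assume j: "j \<in> {..K} - {0, p}"
    have "p dvd p choose j"
      using prime_dvd_choose_middle[OF p, of j] j by (cases "j < p") (auto simp: binomial_eq_0)
    then show "int p dvd ?t j" by simp
  qed
  finally show ?thesis .
qed

lemma lucas_choose:
  assumes p: "prime p" and ml: "m < p" "l < p"
  shows "int p dvd int ((n * p + m) choose (k * p + l)) - int (n choose k) * int (m choose l)"
proof (induction n arbitrary: k)
  case 0
  show ?case
  proof (cases k)
    case (Suc k')
    then have "m < k * p + l" using ml by simp
    then show ?thesis using Suc by (simp add: binomial_eq_0)
  qed simp
next
  case (Suc n)
  have split: "Suc n * p + m = p + (n * p + m)" by simp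
  note step = choose_add_prime[OF p, of "n * p + m" "k * p + l"]
  show ?case
  proof (cases k)
    case 0
    have "int p dvd int ((p + (n * p + m)) choose l) - int ((n * p + m) choose l)"
      using step ml(2) 0 by simp
    from dvd_add[OF this Suc.IH[of 0, simplified]] show ?thesis unfolding split by (simp add: 0)
  next
    case (Suc k')
    have "k * p + l - p = k' * p + l" "p \<le> k * p + l" using Suc by simp_all
    then have "int p dvd int ((p + (n * p + m)) choose (k * p + l)) -
        (int ((n * p + m) choose (k * p + l)) + int ((n * p + m) choose (k' * p + l)))"
      using step by simp
    from dvd_add[OF dvd_add[OF this Suc.IH[of k]] Suc.IH[of k']]
    show ?thesis unfolding split by (simp add: Suc algebra_simps)
  qed
qed

definition lucas_property :: "(nat \<Rightarrow> int) \<Rightarrow> bool" where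
  "lucas_property a \<longleftrightarrow> (\<forall>p n m. prime p \<longrightarrow> m < p \<longrightarrow> int p dvd a (n * p + m) - a n * a m)"

lemma dvd_diff_mult:
  fixes a b c d q :: "'a::comm_ring_1"
  assumes "q dvd a - b" "q dvd c - d" shows "q dvd a * c - b * d"
proof -
  have "a * c - b * d = (a - b) * c + b * (c - d)" by (simp add: algebra_simps)
  also have "q dvd \<dots>" using assms by (intro dvd_add dvd_mult dvd_mult2)
  finally show ?thesis .
qed

lemma lucas_property_mult:
  assumes "lucas_property a" "lucas_property b" shows "lucas_property (\<lambda>n. a n * b n)"
  unfolding lucas_property_def
proof (intro allI impI)
  fix p n m :: nat assume "prime p" "m < p"
  then have "int p dvd a (n * p + m) * b (n * p + m) - (a n * a m) * (b n * b m)"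
    using assms unfolding lucas_property_def by (intro dvd_diff_mult) auto
  then show "int p dvd a (n * p + m) * b (n * p + m) - a n * b n * (a m * b m)"
    by (simp add: mult_ac)
qed

text \<open>
  Summation over \<open>j \<le> n p + m\<close> by the quotient and remainder of
  \<open>j\<close> modulo \<open>p\<close>. The guard matters only for \<open>k = n\<close>.
\<close>

lemma sum_digits:
  fixes n m p :: nat
  assumes m: "m < p"
  shows "(\<Sum>j\<le>n * p + m. F j) = (\<Sum>k\<le>n. \<Sum>l<p. if k * p + l \<le> n * p + m then F (k * p + l) else (0::int))"
proof -
  have p: "p > 0" using m by simp
  have "(\<Sum>k\<le>n. \<Sum>l<p. if k * p + l \<le> n * p + m then F (k * p + l) else 0) =
      (\<Sum>j\<in>{..n} \<times> {..<p}. case j of (k, l) \<Rightarrow> if k * p + l \<le> n * p + m then F (k * p + l) else 0)"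
    by (simp add: sum.cartesian_product)
  also have "\<dots> = (\<Sum>j<Suc n * p. if j \<le> n * p + m then F j else 0)"
  proof (rule sum.reindex_bij_witness[of _ "\<lambda>j. (j div p, j mod p)" "\<lambda>(k, l). k * p + l"])
    fix j assume "j \<in> {..<Suc n * p}"
    then show "(j div p, j mod p) \<in> {..n} \<times> {..<p}"
      using p by (auto simp: less_mult_imp_div_less less_Suc_eq_le[symmetric] simp del: mult_Suc)
  next
    fix x assume "x \<in> {..n} \<times> {..<p}"
    moreover have "k * p + l < Suc n * p" if "k \<le> n" "l < p" for k l
    proof -
      have "k * p + l < Suc k * p" using that by simp
      also have "\<dots> \<le> Suc n * p" using that by (intro mult_le_mono1) simp
      finally show ?thesis .
    qed
    ultimately show "(case x of (k, l) \<Rightarrow> k * p + l) \<in> {..<Suc n * p}" by auto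
  qed (use p in auto)
  also have "\<dots> = (\<Sum>j\<le>n * p + m. F j)"
    using m by (intro sum.mono_neutral_cong_right) auto
  finally show ?thesis by simp
qed

text \<open>
  The sum over \<open>j = k p + l\<close> is the product of the sums over \<open>k\<close>
  and \<open>l\<close>, since binomial coefficients factor in this way. Terms with
  \<open>l > m\<close> are harmless: there \<open>m choose l\<close> is zero.
\<close>

lemma lucas_property_transform:
  assumes a: "lucas_property a"
  shows "lucas_property (\<lambda>n. \<Sum>k\<le>n. int (n choose k) ^ 2 * a k)"
  unfolding lucas_property_def
proof (intro allI impI)
  fix p n m :: nat assume p: "prime p" and m: "m < p"
  let ?c = "\<lambda>N K. int (N choose K) ^ 2"
  have "int p dvd (if k * p + l \<le> n * p + m then ?c (n * p + m) (k * p + l) * a (k * p + l) else 0) -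
      (?c n k * a k) * (?c m l * a l)" if l: "l < p" for k l
  proof -
    let ?x = "int ((n * p + m) choose (k * p + l))"
    have x: "(if k * p + l \<le> n * p + m then ?c (n * p + m) (k * p + l) * a (k * p + l) else 0) =
      (?x * ?x) * a (k * p + l)" by (simp add: power2_eq_square binomial_eq_0)
    have "int p dvd (?x * ?x) * a (k * p + l) -
        ((int (n choose k) * int (m choose l)) * (int (n choose k) * int (m choose l))) * (a k * a l)"
      using a p l unfolding lucas_property_def
      by (intro dvd_diff_mult lucas_choose[OF p m l]) auto
    then show ?thesis unfolding x by (simp add: power2_eq_square mult_ac)
  qed
  then have "int p dvd (\<Sum>k\<le>n. \<Sum>l<p. (if k * p + l \<le> n * p + m then ?c (n * p + m) (k * p + l) * a (k * p + l) else 0) -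
      (?c n k * a k) * (?c m l * a l))"
    by (intro dvd_sum) auto
  also have "\<dots> = (\<Sum>j\<le>n * p + m. ?c (n * p + m) j * a j) - (\<Sum>k\<le>n. ?c n k * a k) * (\<Sum>l<p. ?c m l * a l)"
    unfolding sum_digits[OF m, of "\<lambda>j. ?c (n * p + m) j * a j"] sum_subtractf sum_product ..
  also have "(\<Sum>l<p. ?c m l * a l) = (\<Sum>l\<le>m. ?c m l * a l)"
    using m by (intro sum.mono_neutral_right) (auto simp: binomial_eq_0)
  finally show "int p dvd (\<Sum>k\<le>n * p + m. ?c (n * p + m) k * a k) -
      (\<Sum>k\<le>n. ?c n k * a k) * (\<Sum>k\<le>m. ?c m k * a k)" .
qed

lemma lucas_central_binomial: "lucas_property (\<lambda>n. int ((2 * n) choose n))"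
proof -
  have "lucas_property (\<lambda>n. 1)" by (simp add: lucas_property_def)
  from lucas_property_transform[OF this]
  have "lucas_property (\<lambda>n. int (\<Sum>k\<le>n. (n choose k) ^ 2))" by simp
  then show ?thesis by (simp add: choose_square_sum)
qed

section \<open>Counting closed walks\<close>

text \<open>
  The numbers \<open>x n\<close>, in closed form
  \<open>\<Sum> (n! / (n_1! \<dots> n_d!))^2\<close> over all compositions of
  \<open>n\<close> into \<open>d\<close> nonnegative parts. The recursion splits off one part.
\<close>

fun diag_coeff :: "nat \<Rightarrow> nat \<Rightarrow> nat" where
  "diag_coeff 0 n = (if n = 0 then 1 else 0)"
| "diag_coeff (Suc d) n = (\<Sum>k\<le>n. (n choose k) ^ 2 * diag_coeff d k)"

lemma lucas_diag_coeff: "lucas_property (\<lambda>n. int (diag_coeff d n))"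
proof (induction d)
  case 0
  have "n * p + m = 0 \<longleftrightarrow> n = 0 \<and> m = 0" if "m < p" for n m p :: nat
    using that by auto
  then show ?case by (auto simp: lucas_property_def)
next
  case (Suc d)
  from lucas_property_transform[OF this] show ?case by simp
qed

lemma lists_shuffles:
  assumes "A \<inter> B = {}" "set xs \<subseteq> A" "set ys \<subseteq> B"
  shows "shuffles xs ys = {zs. set zs \<subseteq> A \<union> B \<and> filter (\<lambda>z. z \<in> A) zs = xs \<and> filter (\<lambda>z. z \<in> B) zs = ys}"
proof (intro set_eqI iffI)
  fix zs assume zs: "zs \<in> shuffles xs ys"
  from set_shuffles[OF zs] assms have "set zs \<subseteq> A \<union> B" by auto
  have disj: "set xs \<inter> set ys = {}" using assms by auto
  have "filter (\<lambda>z. z \<in> A) zs = filter (\<lambda>z. z \<in> set xs) zs"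
    using set_shuffles[OF zs] assms by (intro filter_cong) auto
  then have "filter (\<lambda>z. z \<in> A) zs = xs" using filter_shuffles_disjoint1(1)[OF disj zs] by simp
  have "filter (\<lambda>z. z \<in> B) zs = filter (\<lambda>z. z \<in> set ys) zs"
    using set_shuffles[OF zs] assms by (intro filter_cong) auto
  then have "filter (\<lambda>z. z \<in> B) zs = ys" using filter_shuffles_disjoint2(1)[OF disj zs] by simp
  with \<open>set zs \<subseteq> A \<union> B\<close> \<open>filter (\<lambda>z. z \<in> A) zs = xs\<close>
  show "zs \<in> {zs. set zs \<subseteq> A \<union> B \<and> filter (\<lambda>z. z \<in> A) zs = xs \<and> filter (\<lambda>z. z \<in> B) zs = ys}" by simp
next
  fix zs assume zs: "zs \<in> {zs. set zs \<subseteq> A \<union> B \<and> filter (\<lambda>z. z \<in> A) zs = xs \<and> filter (\<lambda>z. z \<in> B) zs = ys}"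
  then have "filter (\<lambda>z. z \<notin> A) zs = filter (\<lambda>z. z \<in> B) zs"
    using assms by (intro filter_cong) auto
  with zs partition_in_shuffles[of zs "\<lambda>z. z \<in> A"] show "zs \<in> shuffles xs ys" by auto
qed

lemma card_shuffle_union:
  assumes fin: "finite X" "finite Y" and disj: "A \<inter> B = {}"
    and X: "\<And>xs. xs \<in> X \<Longrightarrow> set xs \<subseteq> A" and Y: "\<And>ys. ys \<in> Y \<Longrightarrow> set ys \<subseteq> B"
  shows "card {zs. set zs \<subseteq> A \<union> B \<and> filter (\<lambda>z. z \<in> A) zs \<in> X \<and> filter (\<lambda>z. z \<in> B) zs \<in> Y} =
    (\<Sum>xs\<in>X. \<Sum>ys\<in>Y. (length xs + length ys) choose length xs)"
proof -
  have eq: "{zs. set zs \<subseteq> A \<union> B \<and> filter (\<lambda>z. z \<in> A) zs \<in> X \<and> filter (\<lambda>z. z \<in> B) zs \<in> Y} =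
      (\<Union>(xs, ys)\<in>X \<times> Y. shuffles xs ys)"
    using lists_shuffles[OF disj X Y] by auto
  have "card (\<Union>(xs, ys)\<in>X \<times> Y. shuffles xs ys) = (\<Sum>(xs, ys)\<in>X \<times> Y. card (shuffles xs ys))"
    unfolding case_prod_unfold
  proof (rule card_UN_disjoint)
    show "\<forall>i\<in>X \<times> Y. \<forall>j\<in>X \<times> Y. i \<noteq> j \<longrightarrow>
        shuffles (fst i) (snd i) \<inter> shuffles (fst j) (snd j) = {}"
      using lists_shuffles[OF disj X Y] by (auto simp: mem_Times_iff)
  qed (use fin in auto)
  also have "\<dots> = (\<Sum>(xs, ys)\<in>X \<times> Y. (length xs + length ys) choose length xs)"
  proof (intro sum.cong refl, clarify)
    fix xs ys assume "xs \<in> X" "ys \<in> Y"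
    then have "set xs \<inter> set ys = {}" using X Y disj by blast
    then show "card (shuffles xs ys) = (length xs + length ys) choose length xs"
      by (rule card_disjoint_shuffles)
  qed
  finally show ?thesis unfolding eq by (simp add: sum.cartesian_product)
qed

lemma finite_closed_walks: "finite (closed_walks d m)"
proof -
  have "finite (steps d)" by (simp add: steps_def)
  from finite_lists_length_eq[OF this, of m] show ?thesis
    by (rule rev_finite_subset) (auto simp: closed_walks_def)
qed

definition axis_walks :: "nat \<Rightarrow> nat \<Rightarrow> (nat \<Rightarrow> int) list set" where
  "axis_walks d l = {vs. length vs = l \<and> set vs \<subseteq> {unit_vec d, - unit_vec d} \<and> (\<Sum>v\<leftarrow>vs. v d) = 0}"

lemma unit_vec_neq_minus: "unit_vec d \<noteq> - unit_vec d"
  by (auto simp: unit_vec_def fun_eq_iff intro!: exI[of _ d])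

lemma sum_axis_walk:
  assumes "set vs \<subseteq> {unit_vec d, - unit_vec d}"
  shows "(\<Sum>v\<leftarrow>vs. v d) =
    int (length (filter (\<lambda>v. v \<in> {unit_vec d}) vs)) - int (length (filter (\<lambda>v. v \<in> {- unit_vec d}) vs))"
    (is "_ = int (length (filter ?P _)) - int (length (filter ?M _))")
    and "length vs = length (filter (\<lambda>v. v \<in> {unit_vec d}) vs) + length (filter (\<lambda>v. v \<in> {- unit_vec d}) vs)"
proof -
  have "unit_vec d d = 1" by (simp add: unit_vec_def)
  with assms show "(\<Sum>v\<leftarrow>vs. v d) = int (length (filter ?P vs)) - int (length (filter ?M vs))"
    using unit_vec_neq_minus[of d] by (induction vs) auto
  show "length vs = length (filter ?P vs) + length (filter ?M vs)"
    using assms unit_vec_neq_minus[of d] by (induction vs) auto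
qed

lemma card_axis_walks: "card (axis_walks d l) = (if even l then l choose (l div 2) else 0)"
proof -
  let ?e = "unit_vec d" and ?m = "- unit_vec d"
  have filt: "filter (\<lambda>v. v \<in> {x}) vs = replicate (length (filter (\<lambda>v. v \<in> {x}) vs)) x" for x :: "nat \<Rightarrow> int" and vs
    by (rule replicate_length_same[symmetric]) auto
  have mem: "vs \<in> axis_walks d l \<longleftrightarrow> set vs \<subseteq> {?e} \<union> {?m} \<and> (\<exists>k. l = 2 * k \<and>
      filter (\<lambda>v. v \<in> {?e}) vs = replicate k ?e \<and> filter (\<lambda>v. v \<in> {?m}) vs = replicate k ?m)" for vs
  proof
    assume "vs \<in> axis_walks d l"
    then have vs: "length vs = l" "set vs \<subseteq> {?e, ?m}" "(\<Sum>v\<leftarrow>vs. v d) = 0"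
      by (auto simp: axis_walks_def)
    define k where "k = length (filter (\<lambda>v. v \<in> {?e}) vs)"
    have "length (filter (\<lambda>v. v \<in> {?m}) vs) = k" "l = 2 * k"
      using sum_axis_walk[OF vs(2)] vs by (simp_all add: k_def)
    then show "set vs \<subseteq> {?e} \<union> {?m} \<and> (\<exists>k. l = 2 * k \<and>
      filter (\<lambda>v. v \<in> {?e}) vs = replicate k ?e \<and> filter (\<lambda>v. v \<in> {?m}) vs = replicate k ?m)"
      using filt[of ?e vs] filt[of ?m vs] vs(2) unfolding k_def by auto
  next
    assume *: "set vs \<subseteq> {?e} \<union> {?m} \<and> (\<exists>k. l = 2 * k \<and>
      filter (\<lambda>v. v \<in> {?e}) vs = replicate k ?e \<and> filter (\<lambda>v. v \<in> {?m}) vs = replicate k ?m)"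
    then have "set vs \<subseteq> {?e, ?m}" by auto
    from sum_axis_walk[OF this] this * show "vs \<in> axis_walks d l"
      by (auto simp: axis_walks_def)
  qed
  show ?thesis
  proof (cases "even l")
    case True
    then obtain k where k: "l = 2 * k" by blast
    have "axis_walks d l = shuffles (replicate k ?e) (replicate k ?m)"
      using unit_vec_neq_minus[of d] k mem
      by (subst lists_shuffles[of "{?e}" "{?m}"]) (auto simp: set_eq_iff)
    moreover have "card (shuffles (replicate k ?e) (replicate k ?m)) = (k + k) choose k"
      using unit_vec_neq_minus[of d] by (subst card_disjoint_shuffles) auto
    ultimately show ?thesis using k by (simp add: mult_2)
  next
    case False
    then have "axis_walks d l = {}" using mem by auto
    then show ?thesis using False by simp
  qed
qed

lemma steps_Suc: "steps (Suc d) = steps d \<union> {unit_vec d, - unit_vec d}"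
  by (auto simp: steps_def less_Suc_eq)

lemma steps_coordinate: "v \<in> steps d \<Longrightarrow> v d = 0"
  by (auto simp: steps_def unit_vec_def)

lemma axis_coordinate: "v \<in> {unit_vec d, - unit_vec d} \<Longrightarrow> j < d \<Longrightarrow> v j = 0"
  by (auto simp: unit_vec_def)

lemma steps_disjoint: "steps d \<inter> {unit_vec d, - unit_vec d} = {}"
proof -
  have "v d \<noteq> 0" if "v \<in> {unit_vec d, - unit_vec d}" for v
    using that by (auto simp: unit_vec_def)
  then show ?thesis using steps_coordinate by blast
qed

text \<open>
  A closed walk in dimension \<open>d + 1\<close> is a shuffle of a closed walk in the first
  \<open>d\<close> coordinates and a closed walk along the last axis, since neither kind of step
  affects the coordinates of the other.
\<close>

lemma closed_walks_Suc:
  fixes d m :: nat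
  defines "A \<equiv> steps d" and "B \<equiv> {unit_vec d, - unit_vec d}"
  shows "closed_walks (Suc d) m = (\<Union>j\<le>m. {vs. set vs \<subseteq> A \<union> B \<and>
    filter (\<lambda>v. v \<in> A) vs \<in> closed_walks d j \<and> filter (\<lambda>v. v \<in> B) vs \<in> axis_walks d (m - j)})"
proof -
  have key: "vs \<in> closed_walks (Suc d) m \<longleftrightarrow> (\<exists>j\<le>m. filter (\<lambda>v. v \<in> A) vs \<in> closed_walks d j \<and>
      filter (\<lambda>v. v \<in> B) vs \<in> axis_walks d (m - j))" if vs: "set vs \<subseteq> A \<union> B" for vs
  proof -
    let ?a = "filter (\<lambda>v. v \<in> A) vs" and ?b = "filter (\<lambda>v. v \<in> B) vs"
    have "filter (\<lambda>v. v \<notin> A) vs = ?b"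
      using vs steps_disjoint[of d] by (intro filter_cong) (auto simp: A_def B_def)
    then have len: "length vs = length ?a + length ?b"
      using sum_length_filter_compl[of "\<lambda>v. v \<in> A" vs] by simp
    have a: "(\<Sum>v\<leftarrow>?a. v j) = (\<Sum>v\<leftarrow>vs. v j)" if "j < d" for j
      using vs axis_coordinate[OF _ that] by (intro sum_list_map_filter) (auto simp: B_def)
    have b: "(\<Sum>v\<leftarrow>?b. v d) = (\<Sum>v\<leftarrow>vs. v d)"
      using vs steps_coordinate[of _ d] by (intro sum_list_map_filter) (auto simp: A_def)
    have "vs \<in> closed_walks (Suc d) m \<longleftrightarrow>
        length vs = m \<and> (\<forall>j<d. (\<Sum>v\<leftarrow>?a. v j) = 0) \<and> (\<Sum>v\<leftarrow>?b. v d) = 0"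
      using vs a b by (auto simp: closed_walks_def steps_Suc A_def B_def less_Suc_eq)
    also have "\<dots> \<longleftrightarrow> (\<exists>j\<le>m. ?a \<in> closed_walks d j \<and> ?b \<in> axis_walks d (m - j))"
      using len by (auto simp: closed_walks_def axis_walks_def A_def B_def)
    finally show ?thesis .
  qed
  show ?thesis
  proof (rule set_eqI)
    fix vs
    show "vs \<in> closed_walks (Suc d) m \<longleftrightarrow> vs \<in> (\<Union>j\<le>m. {vs. set vs \<subseteq> A \<union> B \<and>
      filter (\<lambda>v. v \<in> A) vs \<in> closed_walks d j \<and> filter (\<lambda>v. v \<in> B) vs \<in> axis_walks d (m - j)})"
    proof (cases "set vs \<subseteq> A \<union> B")
      case True
      with key[OF True] show ?thesis by (simp add: Bex_def)
    next
      case False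
      then have "vs \<notin> closed_walks (Suc d) m"
        by (auto simp: closed_walks_def steps_Suc A_def B_def)
      with False show ?thesis by simp
    qed
  qed
qed

lemma num_closed_walks_Suc:
  "num_closed_walks (Suc d) m =
    (\<Sum>j\<le>m. num_closed_walks d j * card (axis_walks d (m - j)) * (m choose j))"
proof -
  let ?A = "steps d" and ?B = "{unit_vec d, - unit_vec d}"
  let ?W = "\<lambda>j. {vs. set vs \<subseteq> ?A \<union> ?B \<and> filter (\<lambda>v. v \<in> ?A) vs \<in> closed_walks d j \<and>
    filter (\<lambda>v. v \<in> ?B) vs \<in> axis_walks d (m - j)}"
  have fin_axis: "finite (axis_walks d l)" for l
    by (rule rev_finite_subset[OF finite_lists_length_eq[of ?B l]]) (auto simp: axis_walks_def)
  have "finite (?W j)" if "j \<le> m" for j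
    using that finite_closed_walks[of "Suc d" m] unfolding closed_walks_Suc
    by (rule_tac rev_finite_subset[of "\<Union>j\<le>m. ?W j"]) blast+
  then have "num_closed_walks (Suc d) m = (\<Sum>j\<le>m. card (?W j))"
    unfolding num_closed_walks_def closed_walks_Suc
    by (intro card_UN_disjoint) (auto simp: closed_walks_def)
  also have "\<dots> = (\<Sum>j\<le>m. num_closed_walks d j * card (axis_walks d (m - j)) * (m choose j))"
  proof (intro sum.cong refl)
    fix j assume j: "j \<in> {..m}"
    have "card (?W j) = (\<Sum>xs\<in>closed_walks d j. \<Sum>ys\<in>axis_walks d (m - j). (length xs + length ys) choose length xs)"
      by (rule card_shuffle_union[OF finite_closed_walks fin_axis steps_disjoint])
         (auto simp: closed_walks_def axis_walks_def)
    also have "\<dots> = (\<Sum>xs\<in>closed_walks d j. \<Sum>ys\<in>axis_walks d (m - j). m choose j)"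
      using j by (intro sum.cong refl) (auto simp: closed_walks_def axis_walks_def)
    finally show "card (?W j) = num_closed_walks d j * card (axis_walks d (m - j)) * (m choose j)"
      by (simp add: num_closed_walks_def)
  qed
  finally show ?thesis .
qed

text \<open>
  Both sides are \<open>(2n)! / (k!^2 (n-k)!^2)\<close>.
\<close>

lemma choose_double_product:
  assumes "k \<le> n"
  shows "((2 * n) choose (2 * k)) * ((2 * k) choose k) * ((2 * n - 2 * k) choose (n - k)) =
    ((2 * n) choose n) * (n choose k) ^ 2"
proof -
  have n: "2 * n - n = n" "2 * k - k = k" "2 * n - 2 * k - (n - k) = n - k" for n k :: nat
    by simp_all
  have "real (((2 * n) choose (2 * k)) * ((2 * k) choose k) * ((2 * n - 2 * k) choose (n - k))) =
    real (((2 * n) choose n) * (n choose k) ^ 2)"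
    using assms by (simp add: binomial_fact n power2_eq_square)
  then show ?thesis by (simp only: of_nat_eq_iff)
qed

lemma num_closed_walks_eq:
  "num_closed_walks d m = (if even m then (m choose (m div 2)) * diag_coeff d (m div 2) else 0)"
proof (induction d arbitrary: m)
  case 0
  have "closed_walks 0 m = (if m = 0 then {[]} else {})"
    by (auto simp: closed_walks_def steps_def)
  then show ?case by (auto simp: num_closed_walks_def)
next
  case (Suc d)
  let ?t = "\<lambda>j. num_closed_walks d j * card (axis_walks d (m - j)) * (m choose j)"
  show ?case
  proof (cases "even m")
    case False
    then have "?t j = 0" if "j \<le> m" for j using that Suc.IH[of j] card_axis_walks[of d "m - j"] by auto
    then show ?thesis using False by (simp add: num_closed_walks_Suc)
  next
    case True
    then obtain n where n: "m = 2 * n" by blast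
    have "(\<Sum>j\<le>m. ?t j) = (\<Sum>j\<in>(\<lambda>k. 2 * k) ` {..n}. ?t j)"
    proof (rule sum.mono_neutral_right)
      show "\<forall>j\<in>{..m} - (\<lambda>k. 2 * k) ` {..n}. ?t j = 0"
      proof
        fix j assume j: "j \<in> {..m} - (\<lambda>k. 2 * k) ` {..n}"
        have "odd j"
        proof
          assume "even j"
          then obtain k where "j = 2 * k" by blast
          with j n show False by auto
        qed
        then show "?t j = 0" using Suc.IH[of j] by simp
      qed
    qed (use n in auto)
    also have "\<dots> = (\<Sum>k\<le>n. ?t (2 * k))" by (subst sum.reindex) (auto simp: inj_on_def)
    also have "\<dots> = (\<Sum>k\<le>n. ((2 * n) choose n) * ((n choose k) ^ 2 * diag_coeff d k))"
    proof (intro sum.cong refl)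
      fix k assume "k \<in> {..n}"
      then have k: "k \<le> n" by simp
      have "?t (2 * k) = ((2 * n) choose (2 * k)) * ((2 * k) choose k) * ((2 * n - 2 * k) choose (n - k)) * diag_coeff d k"
        using Suc.IH[of "2 * k"] card_axis_walks[of d "m - 2 * k"] k by (simp add: n flip: right_diff_distrib')
      then show "?t (2 * k) = ((2 * n) choose n) * ((n choose k) ^ 2 * diag_coeff d k)"
        unfolding choose_double_product[OF k] by (simp add: mult_ac)
    qed
    finally show ?thesis by (simp add: num_closed_walks_Suc n sum_distrib_left)
  qed
qed

lemma walk_ratio_eq: "walk_ratio d n = of_nat (diag_coeff d n)"
proof -
  have "(2 * n) choose n \<noteq> 0" by simp
  then show ?thesis by (simp add: walk_ratio_def num_closed_walks_eq del: binomial_eq_0_iff)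
qed

section \<open>First-order equations and growth of coefficients\<close>

lemma poly_bounded_away:
  fixes q :: "real poly"
  assumes "poly q \<rho> \<noteq> 0" "\<rho> > 0"
  obtains x0 \<delta> where "0 \<le> x0" "x0 < \<rho>" "\<delta> > 0" "\<And>x. x0 \<le> x \<Longrightarrow> x \<le> \<rho> \<Longrightarrow> \<delta> \<le> \<bar>poly q x\<bar>"
proof -
  have "continuous (at \<rho>) (\<lambda>x. poly q x)" by simp
  then obtain d where d: "d > 0" "\<And>x. \<bar>x - \<rho>\<bar> < d \<Longrightarrow> \<bar>poly q x - poly q \<rho>\<bar> < \<bar>poly q \<rho>\<bar> / 2"
    using assms unfolding continuous_at_eps_delta dist_real_def
    by (metis half_gt_zero zero_less_abs_iff)
  define x0 where "x0 = max 0 (\<rho> - d / 2)"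
  have "\<bar>poly q \<rho>\<bar> / 2 \<le> \<bar>poly q x\<bar>" if "x0 \<le> x" "x \<le> \<rho>" for x
  proof -
    have "\<bar>x - \<rho>\<bar> < d" using that d(1) by (auto simp: x0_def)
    from d(2)[OF this] show ?thesis by linarith
  qed
  moreover have "0 \<le> x0" "x0 < \<rho>" using d(1) assms(2) by (auto simp: x0_def)
  ultimately show thesis using that[of x0 "\<bar>poly q \<rho>\<bar> / 2"] assms(1) by simp
qed

lemma poly_bounded:
  fixes q :: "real poly"
  obtains K where "K > 0" "\<And>x. 0 \<le> x \<Longrightarrow> x \<le> \<rho> \<Longrightarrow> \<bar>poly q x\<bar> \<le> K"
proof -
  have "bounded (poly q ` {0..\<rho>})"
    by (intro compact_imp_bounded compact_continuous_image continuous_intros) auto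
  then obtain K where "K > 0" "\<And>y. y \<in> poly q ` {0..\<rho>} \<Longrightarrow> norm y \<le> K"
    unfolding bounded_pos by blast
  with that[of K] show thesis by force
qed

context
  fixes a :: "nat \<Rightarrow> real" and R c C :: real and T :: nat
  assumes R: "R > 0" and c: "c > 0"
    and upper: "\<And>n. real (n + 1) * a n \<le> C * R ^ n"
    and lower: "\<And>n. c * R ^ n \<le> a n * real (n + 1) ^ T"
begin

text \<open>
  By the two bounds on \<open>a\<close> this is the radius of convergence.
\<close>

definition radius :: real where "radius = 1 / R"

lemma radius_pos: "radius > 0" using R by (simp add: radius_def)

lemma a_pos: "a n > 0"
proof -
  have "0 < a n * real (n + 1) ^ T" using lower[of n] R c by (metis less_le_trans mult_pos_pos zero_less_power)
  then show ?thesis by (simp add: zero_less_mult_iff)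
qed

lemma C_pos: "C > 0"
  using upper[of 0] a_pos[of 0] by simp

definition nth_deriv :: "nat \<Rightarrow> real fps" where "nth_deriv k = (fps_deriv ^^ k) (Abs_fps a)"

lemma nth_deriv_simps: "nth_deriv 0 = Abs_fps a" "fps_deriv (nth_deriv k) = nth_deriv (Suc k)"
  by (simp_all add: nth_deriv_def)

lemma conv_radius_nth_deriv: "ereal radius \<le> fps_conv_radius (nth_deriv k)"
proof (induction k)
  case 0
  have "ereal radius \<le> conv_radius a"
  proof (rule conv_radius_geI_ex)
    fix r assume r: "0 < r" "ereal r < ereal radius"
    have majorant: "summable (\<lambda>n. C * (R * r) ^ n)"
      using r R by (intro summable_mult summable_geometric) (simp add: radius_def field_simps)
    have "norm (a n * r ^ n) \<le> C * (R * r) ^ n" for n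
    proof -
      have "1 * a n \<le> real (n + 1) * a n" using a_pos[of n] by (intro mult_right_mono) auto
      then have "a n * r ^ n \<le> C * R ^ n * r ^ n" using upper[of n] r by (intro mult_right_mono) auto
      then show ?thesis using a_pos[of n] r by (simp add: power_mult_distrib)
    qed
    then have "summable (\<lambda>n. a n * r ^ n)"
      by (rule summable_comparison_test'[OF majorant])
    then show "\<exists>z. norm z = r \<and> summable (\<lambda>n. a n * z ^ n)" using r by (intro exI[of _ r]) auto
  qed
  then show ?case by (simp add: nth_deriv_def fps_conv_radius_def)
next
  case (Suc k)
  then show ?case using fps_conv_radius_deriv[of "nth_deriv k"]
    unfolding nth_deriv_simps by (rule order_trans)
qed

lemma less_conv_radius: "0 \<le> x \<Longrightarrow> x < radius \<Longrightarrow> ereal (norm x) < fps_conv_radius (nth_deriv k)"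
  using conv_radius_nth_deriv[of k] by (intro less_le_trans[OF _ conv_radius_nth_deriv]) auto

lemma nth_deriv_lower: "real (m + 1) ^ k * a (m + k) \<le> nth_deriv k $ m"
proof (induction k arbitrary: m)
  case (Suc k)
  have "real (m + 1) ^ Suc k * a (m + Suc k) = real (m + 1) * (real (m + 1) ^ k * a (Suc m + k))"
    by simp
  also have "\<dots> \<le> real (m + 1) * (real (Suc m + 1) ^ k * a (Suc m + k))"
    using a_pos by (intro mult_left_mono mult_right_mono power_mono) (auto intro: less_imp_le)
  also have "\<dots> \<le> real (m + 1) * nth_deriv k $ (Suc m)"
    using Suc.IH[of "Suc m"] by (intro mult_left_mono) auto
  finally show ?case by (simp flip: nth_deriv_simps(2))
qed (simp add: nth_deriv_def)

lemma nth_deriv_nonneg: "0 \<le> nth_deriv k $ m"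
  using nth_deriv_lower[of m k] a_pos[of "m + k"]
  by (meson less_imp_le mult_nonneg_nonneg of_nat_0_le_iff order_trans zero_le_power)

abbreviation G :: "nat \<Rightarrow> real \<Rightarrow> real" where "G k \<equiv> eval_fps (nth_deriv k)"

lemma DERIV_G: "0 \<le> x \<Longrightarrow> x < radius \<Longrightarrow> (G k has_real_derivative G (Suc k) x) (at x)"
  using has_field_derivative_eval_fps[OF less_conv_radius] by (simp add: nth_deriv_simps)

lemma G_ge_term: "0 \<le> x \<Longrightarrow> x < radius \<Longrightarrow> nth_deriv k $ m * x ^ m \<le> G k x"
proof -
  assume x: "0 \<le> x" "x < radius"
  have "(\<Sum>n\<in>{m}. nth_deriv k $ n * x ^ n) \<le> (\<Sum>n. nth_deriv k $ n * x ^ n)"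
    using x nth_deriv_nonneg by (intro sum_le_suminf summable_fps less_conv_radius) auto
  then show ?thesis by (simp add: eval_fps_def)
qed

lemma G_nonneg: "0 \<le> x \<Longrightarrow> x < radius \<Longrightarrow> 0 \<le> G k x"
  using G_ge_term[of x k 0] nth_deriv_nonneg[of k 0] by simp

lemma G_mono:
  assumes "0 \<le> x" "x \<le> y" "y < radius" shows "G k x \<le> G k y"
proof (rule DERIV_nonneg_imp_nondecreasing[OF assms(2)])
  fix z assume "x \<le> z" "z \<le> y"
  then have "0 \<le> z" "z < radius" using assms by auto
  then show "\<exists>D. (G k has_real_derivative D) (at z) \<and> 0 \<le> D"
    using DERIV_G G_nonneg by blast
qed

lemma G_0_pos: "0 \<le> x \<Longrightarrow> x < radius \<Longrightarrow> G 0 x > 0"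
  using G_ge_term[of x 0 0] a_pos[of 0] by (simp add: nth_deriv_def)

text \<open>
  The only use of the factor \<open>n + 1\<close> in the upper bound: \<open>n * a n\<close>
  is bounded by a geometric sequence, so the derivative grows at most like a simple pole at the
  radius of convergence.
\<close>

lemma first_derivative_upper:
  assumes "0 \<le> x" "x < radius" shows "(radius - x) * G 1 x \<le> C"
proof -
  have Rx: "0 \<le> R * x" "R * x < 1" using assms R by (auto simp: radius_def field_simps)
  have "G 1 x = (\<Sum>n. nth_deriv 1 $ n * x ^ n)" by (simp add: eval_fps_def)
  also have "\<dots> \<le> (\<Sum>n. C * R * (R * x) ^ n)"
  proof (rule suminf_le)
    fix n
    have "nth_deriv 1 $ n = real (n + 1) * a (n + 1)" by (simp add: nth_deriv_def)
    also have "\<dots> \<le> real (n + 1 + 1) * a (n + 1)" using a_pos[of "n + 1"] by (intro mult_right_mono) auto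
    also have "\<dots> \<le> C * R ^ (n + 1)" by (rule upper)
    finally have "nth_deriv 1 $ n * x ^ n \<le> C * R ^ (n + 1) * x ^ n"
      using assms by (intro mult_right_mono) auto
    then show "nth_deriv 1 $ n * x ^ n \<le> C * R * (R * x) ^ n"
      by (simp add: power_mult_distrib mult_ac)
  qed (use assms Rx in \<open>auto intro!: summable_fps less_conv_radius summable_mult summable_geometric\<close>)
  also have "\<dots> = C * R / (1 - R * x)"
    using Rx by (subst suminf_mult) (auto simp: suminf_geometric summable_geometric)
  also have "\<dots> = C / (radius - x)" using R Rx by (simp add: radius_def field_simps)
  finally show ?thesis using assms by (simp add: field_simps)
qed

definition bounded_to_radius :: "(real \<Rightarrow> real) \<Rightarrow> bool" where
  "bounded_to_radius g \<longleftrightarrow> (\<exists>B. \<forall>x. 0 \<le> x \<longrightarrow> x < radius \<longrightarrow> \<bar>g x\<bar> \<le> B)"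

lemma bdd_add: "bounded_to_radius g \<Longrightarrow> bounded_to_radius h \<Longrightarrow> bounded_to_radius (\<lambda>x. g x + h x)"
  unfolding bounded_to_radius_def by (meson abs_triangle_ineq add_mono order_trans)

lemma bdd_sum: "finite I \<Longrightarrow> (\<And>i. i \<in> I \<Longrightarrow> bounded_to_radius (g i)) \<Longrightarrow> bounded_to_radius (\<lambda>x. \<Sum>i\<in>I. g i x)"
proof (induction I rule: finite_induct)
  case empty
  then show ?case by (auto simp: bounded_to_radius_def)
next
  case (insert i I)
  then show ?case using bdd_add[of "g i" "\<lambda>x. \<Sum>i\<in>I. g i x"] by simp
qed

lemma bdd_poly_mult:
  assumes "bounded_to_radius g" shows "bounded_to_radius (\<lambda>x. poly q x * g x)"
proof -
  obtain B where B: "\<And>x. 0 \<le> x \<Longrightarrow> x < radius \<Longrightarrow> \<bar>g x\<bar> \<le> B" using assms by (auto simp: bounded_to_radius_def)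
  obtain K where K: "K > 0" "\<And>x. 0 \<le> x \<Longrightarrow> x \<le> radius \<Longrightarrow> \<bar>poly q x\<bar> \<le> K" using poly_bounded by blast
  have "\<bar>poly q x * g x\<bar> \<le> K * B" if "0 \<le> x" "x < radius" for x
    unfolding abs_mult using that B K by (intro mult_mono) auto
  then show ?thesis unfolding bounded_to_radius_def by blast
qed

text \<open>
  Near the radius of convergence \<open>q\<close> is bounded away from zero; further left,
  monotonicity suffices.
\<close>

lemma bdd_cancel_poly:
  assumes q: "poly q radius \<noteq> 0" and bdd: "bounded_to_radius (\<lambda>x. poly q x * G k x)"
  shows "bounded_to_radius (G k)"
proof -
  obtain B where B: "\<And>x. 0 \<le> x \<Longrightarrow> x < radius \<Longrightarrow> \<bar>poly q x * G k x\<bar> \<le> B"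
    using bdd by (auto simp: bounded_to_radius_def)
  obtain x0 \<delta> where x0: "0 \<le> x0" "x0 < radius" "\<delta> > 0"
    "\<And>x. x0 \<le> x \<Longrightarrow> x \<le> radius \<Longrightarrow> \<delta> \<le> \<bar>poly q x\<bar>"
    using poly_bounded_away[OF q radius_pos] by blast
  have near: "G k x \<le> B / \<delta>" if "x0 \<le> x" "x < radius" for x
  proof -
    have "\<delta> * G k x \<le> \<bar>poly q x\<bar> * G k x"
      using that x0 by (intro mult_right_mono G_nonneg) auto
    also have "\<dots> \<le> B" using B[of x] that x0 G_nonneg[of x k] by (simp add: abs_mult)
    finally show ?thesis using x0 by (simp add: field_simps)
  qed
  have "\<bar>G k x\<bar> \<le> B / \<delta>" if "0 \<le> x" "x < radius" for x
    using near[of "max x x0"] G_mono[of x "max x x0" k] G_nonneg[OF that] that x0 by auto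
  then show ?thesis unfolding bounded_to_radius_def by blast
qed

text \<open>
  A bound for the derivative of order \<open>T + 1\<close> bounds each of its nonnegative terms,
  at the radius of convergence too. That makes \<open>a n / R^n\<close> of order
  \<open>1 / n^(T+1)\<close>, against the lower bound.
\<close>

lemma high_derivative_unbounded: "\<not> bounded_to_radius (G (Suc T))"
proof
  assume "bounded_to_radius (G (Suc T))"
  then obtain B where B: "\<And>x. 0 \<le> x \<Longrightarrow> x < radius \<Longrightarrow> \<bar>G (Suc T) x\<bar> \<le> B" by (auto simp: bounded_to_radius_def)
  let ?k = "Suc T"
  have bound: "nth_deriv ?k $ m * radius ^ m \<le> B" for m
  proof (rule tendsto_upperbound)
    show "((\<lambda>x. nth_deriv ?k $ m * x ^ m) \<longlongrightarrow> nth_deriv ?k $ m * radius ^ m) (at_left radius)"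
      by (intro tendsto_intros)
    have "\<forall>\<^sub>F x in at_left radius. x \<in> {0<..<radius}"
      using radius_pos by (rule eventually_at_left_real)
    then show "\<forall>\<^sub>F x in at_left radius. nth_deriv ?k $ m * x ^ m \<le> B"
    proof eventually_elim
      case (elim x)
      then show ?case using G_ge_term[of x ?k m] B[of x] by auto
    qed
  qed simp
  have "real (m + 1) * (c * R ^ ?k) \<le> B * real (?k + 1) ^ T" for m
  proof -
    have "real (m + 1) ^ ?k * (c * R ^ (m + ?k)) \<le> real (m + 1) ^ ?k * (a (m + ?k) * real (m + ?k + 1) ^ T)"
      by (intro mult_left_mono lower) auto
    also have "\<dots> \<le> nth_deriv ?k $ m * real (m + ?k + 1) ^ T"
      using nth_deriv_lower[of m ?k] by (simp only: mult.assoc[symmetric]) (intro mult_right_mono, auto)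
    also have "\<dots> \<le> nth_deriv ?k $ m * (real (m + 1) * real (?k + 1)) ^ T"
      using nth_deriv_nonneg by (intro mult_left_mono power_mono) (auto simp: algebra_simps)
    finally have "real (m + 1) ^ ?k * (c * R ^ (m + ?k)) * radius ^ m
        \<le> nth_deriv ?k $ m * (real (m + 1) * real (?k + 1)) ^ T * radius ^ m"
      using radius_pos by (intro mult_right_mono) auto
    also have "\<dots> = (nth_deriv ?k $ m * radius ^ m) * (real (m + 1) * real (?k + 1)) ^ T"
      by (simp only: mult_ac)
    also have "\<dots> \<le> B * (real (m + 1) * real (?k + 1)) ^ T"
      by (intro mult_right_mono bound) auto
    also have "real (m + 1) ^ ?k * (c * R ^ (m + ?k)) * radius ^ m =
        real (m + 1) ^ T * (real (m + 1) * (c * R ^ ?k))"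
    proof -
      have "R ^ m * radius ^ m = 1" using R by (simp add: radius_def flip: power_mult_distrib)
      then show ?thesis by (simp only: power_add power_Suc mult_ac mult_1_left mult_1_right)
          (simp add: mult_ac)
    qed
    also have "B * (real (m + 1) * real (?k + 1)) ^ T = real (m + 1) ^ T * (B * real (?k + 1) ^ T)"
      by (simp only: power_mult_distrib mult_ac)
    finally show ?thesis by (rule mult_left_le_imp_le) simp
  qed
  moreover have "c * R ^ ?k > 0" using c R by simp
  then obtain m where "B * real (?k + 1) ^ T < real m * (c * R ^ ?k)"
    using reals_Archimedean3 by blast
  ultimately show False using \<open>c * R ^ ?k > 0\<close>
    by (smt (verit) mult_right_mono of_nat_add of_nat_1)
qed

text \<open>
  Repeated differentiation of the equation never changes the factor in front of the highest
  derivative.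
\<close>

lemma nth_deriv_combination:
  assumes rel: "fps_of_poly q * nth_deriv 1 = fps_of_poly n * nth_deriv 0"
  shows "\<exists>r. fps_of_poly q * nth_deriv (Suc k) = (\<Sum>i\<le>k. fps_of_poly (r i) * nth_deriv i)"
proof (induction k)
  case 0
  show ?case using rel by (intro exI[of _ "\<lambda>_. n"]) simp
next
  case (Suc k)
  then obtain r where r: "fps_of_poly q * nth_deriv (Suc k) = (\<Sum>i\<le>k. fps_of_poly (r i) * nth_deriv i)" by blast
  define r' where "r' i = (if i \<le> k then pderiv (r i) else 0) + (if i > 0 then r (i - 1) else 0)
    - (if i = Suc k then pderiv q else 0)" for i
  have "fps_of_poly q * nth_deriv (Suc (Suc k)) =
      fps_deriv (fps_of_poly q * nth_deriv (Suc k)) - fps_of_poly (pderiv q) * nth_deriv (Suc k)"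
    by (simp add: fps_of_poly_pderiv nth_deriv_simps)
  also have "fps_deriv (fps_of_poly q * nth_deriv (Suc k)) =
      (\<Sum>i\<le>k. fps_of_poly (pderiv (r i)) * nth_deriv i) + (\<Sum>i\<le>k. fps_of_poly (r i) * nth_deriv (Suc i))"
    unfolding r by (simp add: fps_deriv_sum fps_of_poly_pderiv nth_deriv_simps sum.distrib add.commute)
  also have "(\<Sum>i\<le>k. fps_of_poly (pderiv (r i)) * nth_deriv i) =
      (\<Sum>i\<le>Suc k. fps_of_poly (if i \<le> k then pderiv (r i) else 0) * nth_deriv i)"
    by simp
  also have "(\<Sum>i\<le>k. fps_of_poly (r i) * nth_deriv (Suc i)) =
      (\<Sum>i\<le>Suc k. fps_of_poly (if i > 0 then r (i - 1) else 0) * nth_deriv i)"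
    by (subst sum.atMost_Suc_shift) simp
  also have "fps_of_poly (pderiv q) * nth_deriv (Suc k) =
      (\<Sum>i\<le>Suc k. fps_of_poly (if i = Suc k then pderiv q else 0) * nth_deriv i)"
    by simp
  finally have "fps_of_poly q * nth_deriv (Suc (Suc k)) = (\<Sum>i\<le>Suc k. fps_of_poly (r' i) * nth_deriv i)"
    unfolding sum.distrib[symmetric] sum_subtractf[symmetric] r'_def
    by (simp only: fps_of_poly_add fps_of_poly_diff distrib_right left_diff_distrib)
  then show ?case by blast
qed

lemma eval_poly_mult: "0 \<le> x \<Longrightarrow> x < radius \<Longrightarrow> eval_fps (fps_of_poly q * nth_deriv k) x = poly q x * G k x"
  using less_conv_radius[of x k] by (subst eval_fps_mult) auto

lemma eval_poly_mult_sum: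
  assumes "0 \<le> x" "x < radius"
  shows "eval_fps (\<Sum>i\<le>k. fps_of_poly (r i) * nth_deriv i) x = (\<Sum>i\<le>k. poly (r i) x * G i x)"
    and "ereal (norm x) < fps_conv_radius (\<Sum>i\<le>k. fps_of_poly (r i) * nth_deriv i)"
proof -
  have conv: "ereal (norm x) < fps_conv_radius (fps_of_poly (r i) * nth_deriv i)" for i
    using less_conv_radius[OF assms, of i]
    by (intro less_le_trans[OF _ fps_conv_radius_mult]) simp
  have "eval_fps (\<Sum>i\<le>k. fps_of_poly (r i) * nth_deriv i) x = (\<Sum>i\<le>k. poly (r i) x * G i x) \<and>
    ereal (norm x) < fps_conv_radius (\<Sum>i\<le>k. fps_of_poly (r i) * nth_deriv i)"
  proof (induction k)
    case 0
    then show ?case using conv[of 0] eval_poly_mult[OF assms, of "r 0" 0] by simp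
  next
    case (Suc k)
    let ?S = "\<Sum>i\<le>k. fps_of_poly (r i) * nth_deriv i"
    have "ereal (norm x) < fps_conv_radius (?S + fps_of_poly (r (Suc k)) * nth_deriv (Suc k))"
      using Suc conv[of "Suc k"] by (intro less_le_trans[OF _ fps_conv_radius_add]) simp
    moreover have "eval_fps (?S + fps_of_poly (r (Suc k)) * nth_deriv (Suc k)) x =
        eval_fps ?S x + poly (r (Suc k)) x * G (Suc k) x"
      using Suc conv[of "Suc k"] eval_poly_mult[OF assms] by (subst eval_fps_add) auto
    ultimately show ?case using Suc by simp
  qed
  then show "eval_fps (\<Sum>i\<le>k. fps_of_poly (r i) * nth_deriv i) x = (\<Sum>i\<le>k. poly (r i) x * G i x)"
    "ereal (norm x) < fps_conv_radius (\<Sum>i\<le>k. fps_of_poly (r i) * nth_deriv i)" by auto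
qed

text \<open>
  If the equation is regular at the radius of convergence, \<open>f' \<le> L f\<close> near it
  keeps \<open>f\<close> bounded by Gronwall's argument, and then the equation bounds all
  derivatives in turn.
\<close>

lemma regular_contradiction:
  assumes rel: "fps_of_poly q * nth_deriv 1 = fps_of_poly n * nth_deriv 0"
    and q: "poly q radius \<noteq> 0"
  shows False
proof -
  have pointwise: "poly q x * G 1 x = poly n x * G 0 x" if "0 \<le> x" "x < radius" for x
    using arg_cong[OF rel, of "\<lambda>f. eval_fps f x"] eval_poly_mult[OF that] by simp
  obtain x0 \<delta> where x0: "0 \<le> x0" "x0 < radius" "\<delta> > 0"
    "\<And>x. x0 \<le> x \<Longrightarrow> x \<le> radius \<Longrightarrow> \<delta> \<le> \<bar>poly q x\<bar>"
    using poly_bounded_away[OF q radius_pos] by blast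
  obtain K where K: "K > 0" "\<And>x. 0 \<le> x \<Longrightarrow> x \<le> radius \<Longrightarrow> \<bar>poly n x\<bar> \<le> K" using poly_bounded by blast
  define L where "L = K / \<delta>"
  have growth: "G 1 x \<le> L * G 0 x" if x: "x0 \<le> x" "x < radius" for x
  proof -
    have x': "0 \<le> x" using x x0 by simp
    have "\<delta> * G 1 x \<le> \<bar>poly q x\<bar> * G 1 x"
      using x x0 by (intro mult_right_mono G_nonneg) auto
    also have "\<dots> = \<bar>poly n x\<bar> * G 0 x"
      using pointwise[OF x' x(2)] G_nonneg[OF x' x(2)] by (metis abs_mult abs_of_nonneg)
    also have "\<dots> \<le> K * G 0 x" using K x x' by (intro mult_right_mono G_nonneg) auto
    finally show ?thesis using x0(3) by (simp add: L_def field_simps)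
  qed
  have near: "G 0 x \<le> G 0 x0 * exp (L * (radius - x0))" if x: "x0 \<le> x" "x < radius" for x
  proof -
    have "G 0 x * exp (- L * x) \<le> G 0 x0 * exp (- L * x0)"
    proof (rule DERIV_nonpos_imp_nonincreasing[OF x(1)])
      fix y assume y: "x0 \<le> y" "y \<le> x"
      then have y': "0 \<le> y" "y < radius" using x x0 by auto
      have "((\<lambda>x. G 0 x * exp (- L * x)) has_real_derivative (G 1 y - L * G 0 y) * exp (- L * y)) (at y)"
        using DERIV_G[OF y', of 0] by (auto intro!: derivative_eq_intros simp: algebra_simps)
      moreover have "(G 1 y - L * G 0 y) * exp (- L * y) \<le> 0"
        using growth[of y] y y' by (intro mult_nonpos_nonneg) auto
      ultimately show "\<exists>z. ((\<lambda>x. G 0 x * exp (- L * x)) has_real_derivative z) (at y) \<and> z \<le> 0" by blast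
    qed
    then have "G 0 x * exp (- L * x) * exp (L * x) \<le> G 0 x0 * exp (- L * x0) * exp (L * x)"
      by (rule mult_right_mono) simp
    then have "G 0 x \<le> G 0 x0 * exp (L * (x - x0))"
      by (simp add: mult.assoc flip: exp_add) (simp add: algebra_simps)
    also have "\<dots> \<le> G 0 x0 * exp (L * (radius - x0))"
      using x x0 K G_nonneg[of x0 0] by (intro mult_left_mono) (auto simp: L_def intro!: divide_right_mono mult_left_mono)
    finally show ?thesis .
  qed
  have "\<bar>G 0 x\<bar> \<le> G 0 x0 * exp (L * (radius - x0))" if "0 \<le> x" "x < radius" for x
    using near[of "max x x0"] G_mono[of x "max x x0" 0] G_nonneg[OF that, of 0] that x0 by auto
  then have base: "bounded_to_radius (G 0)" unfolding bounded_to_radius_def by blast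
  have "bounded_to_radius (G k)" for k
  proof (induction k rule: less_induct)
    case (less k)
    show ?case
    proof (cases k)
      case 0
      then show ?thesis using base by simp
    next
      case (Suc j)
      obtain r where r: "fps_of_poly q * nth_deriv (Suc j) = (\<Sum>i\<le>j. fps_of_poly (r i) * nth_deriv i)"
        using nth_deriv_combination[OF rel] by blast
      have "poly q x * G (Suc j) x = (\<Sum>i\<le>j. poly (r i) x * G i x)" if "0 \<le> x" "x < radius" for x
        using arg_cong[OF r, of "\<lambda>f. eval_fps f x"] eval_poly_mult[OF that] eval_poly_mult_sum(1)[OF that] by simp
      moreover have "bounded_to_radius (\<lambda>x. \<Sum>i\<le>j. poly (r i) x * G i x)"
        using less.IH Suc by (intro bdd_sum bdd_poly_mult) auto
      ultimately have "bounded_to_radius (\<lambda>x. poly q x * G (Suc j) x)" unfolding bounded_to_radius_def by auto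
      then show ?thesis unfolding Suc by (rule bdd_cancel_poly[OF q])
    qed
  qed
  then show False using high_derivative_unbounded by blast
qed

text \<open>
  If \<open>f'/f\<close> has a pole at the radius \<open>\<rho>\<close> of convergence,
  \<open>(\<rho> - x) f'\<close> is at least a positive multiple of \<open>f\<close>. On the
  one hand this bounds \<open>f\<close>, because \<open>(\<rho> - x) f'\<close> is bounded. On
  the other hand it bounds \<open>f'\<close> below by \<open>e / (\<rho> - x)\<close>, so that
  \<open>f\<close> tends to infinity like a logarithm.
\<close>

lemma pole_contradiction:
  assumes rel: "fps_of_poly q * nth_deriv 1 = fps_of_poly n * nth_deriv 0"
    and q: "poly q radius = 0" and n: "poly n radius \<noteq> 0"
  shows False
proof -
  have pointwise: "poly q x * G 1 x = poly n x * G 0 x" if "0 \<le> x" "x < radius" for x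
    using arg_cong[OF rel, of "\<lambda>f. eval_fps f x"] eval_poly_mult[OF that] by simp
  obtain q1 where q1: "q = [:- radius, 1:] * q1" using q by (auto simp: poly_eq_0_iff_dvd elim: dvdE)
  obtain x0 \<delta> where x0: "0 \<le> x0" "x0 < radius" "\<delta> > 0"
    "\<And>x. x0 \<le> x \<Longrightarrow> x \<le> radius \<Longrightarrow> \<delta> \<le> \<bar>poly n x\<bar>"
    using poly_bounded_away[OF n radius_pos] by blast
  obtain K where K: "K > 0" "\<And>x. 0 \<le> x \<Longrightarrow> x \<le> radius \<Longrightarrow> \<bar>poly q1 x\<bar> \<le> K" using poly_bounded by blast
  have growth: "\<delta> * G 0 x \<le> K * ((radius - x) * G 1 x)" if x: "x0 \<le> x" "x < radius" for x
  proof -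
    have x': "0 \<le> x" using x x0 by simp
    have nonneg: "0 \<le> (radius - x) * G 1 x" using G_nonneg[OF x' x(2)] x by simp
    have "\<delta> * G 0 x \<le> \<bar>poly n x\<bar> * G 0 x" using x x0 by (intro mult_right_mono G_nonneg) auto
    also have "\<dots> = \<bar>poly q x * G 1 x\<bar>"
      using pointwise[OF x' x(2)] G_nonneg[OF x' x(2), of 0] by (simp add: abs_mult)
    also have "\<dots> = \<bar>poly q1 x\<bar> * ((radius - x) * G 1 x)"
    proof -
      have "poly q x = (x - radius) * poly q1 x" by (simp add: q1 algebra_simps)
      moreover have "\<bar>x - radius\<bar> = radius - x" using x by simp
      ultimately show ?thesis using G_nonneg[OF x' x(2), of 1] by (simp add: abs_mult)
    qed
    also have "\<dots> \<le> K * ((radius - x) * G 1 x)" using K x x' nonneg by (intro mult_right_mono) auto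
    finally show ?thesis .
  qed
  have bounded: "G 0 x \<le> K * C / \<delta>" if x: "x0 \<le> x" "x < radius" for x
  proof -
    have "\<delta> * G 0 x \<le> K * C"
      using growth[OF x] first_derivative_upper[of x] x x0 K(1) by (smt (verit) mult_left_mono)
    then show ?thesis using x0(3) by (simp add: field_simps)
  qed
  define e where "e = \<delta> * G 0 x0 / K"
  have e: "e > 0" using x0 K G_0_pos[of x0] by (simp add: e_def)
  have slope: "e / (radius - x) \<le> G 1 x" if x: "x0 \<le> x" "x < radius" for x
  proof -
    have "\<delta> * G 0 x0 \<le> \<delta> * G 0 x" using x x0 G_mono[of x0 x 0] by (intro mult_left_mono) auto
    with growth[OF x] have "e \<le> (radius - x) * G 1 x" using K by (simp add: e_def field_simps)
    then show ?thesis using x by (simp add: field_simps)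
  qed
  have log_growth: "e * (ln (radius - x0) - ln (radius - x)) \<le> K * C / \<delta>" if x: "x0 \<le> x" "x < radius" for x
  proof -
    have "G 0 x0 + e * ln (radius - x0) \<le> G 0 x + e * ln (radius - x)"
    proof (rule DERIV_nonneg_imp_nondecreasing[OF x(1)])
      fix y assume y: "x0 \<le> y" "y \<le> x"
      then have y': "0 \<le> y" "y < radius" using x x0 by auto
      have "((\<lambda>x. G 0 x + e * ln (radius - x)) has_real_derivative G 1 y - e / (radius - y)) (at y)"
        using DERIV_G[OF y', of 0] y' by (auto intro!: derivative_eq_intros simp: field_simps)
      moreover have "0 \<le> G 1 y - e / (radius - y)" using slope[of y] y y' by simp
      ultimately show "\<exists>z. ((\<lambda>x. G 0 x + e * ln (radius - x)) has_real_derivative z) (at y) \<and> 0 \<le> z" by blast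
    qed
    then show ?thesis using bounded[OF x] G_0_pos[of x0] x0 by (simp add: right_diff_distrib)
  qed
  \<comment> \<open>the point where the logarithm has grown by \<open>M\<close>, too much for the bound\<close>
  define M where "M = K * C / (\<delta> * e) + 1"
  have M: "M > 0" using K C_pos x0 e by (simp add: M_def add_pos_pos)
  define x where "x = radius - (radius - x0) * exp (- M)"
  have "(radius - x0) * exp (- M) \<le> radius - x0" using x0 M by (simp add: mult_left_le)
  then have "x0 \<le> x" unfolding x_def by linarith
  moreover have "x < radius" using x0 by (simp add: x_def)
  ultimately have "e * (ln (radius - x0) - ln (radius - x)) \<le> K * C / \<delta>" by (rule log_growth)
  then have "e * M \<le> K * C / \<delta>" using x0 by (simp add: x_def ln_mult)
  moreover have "e * M = K * C / \<delta> + e" using e x0(3) by (simp add: M_def field_simps)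
  ultimately show False using e by simp
qed

text \<open>
  A common zero of \<open>q\<close> and \<open>n\<close> at the radius of convergence can be
  cancelled; the two remaining cases are those of a regular point and of a pole.
\<close>

lemma no_first_order_equation:
  assumes "q \<noteq> 0" "fps_of_poly q * fps_deriv (Abs_fps a) = fps_of_poly n * Abs_fps a"
  shows False
  using assms
proof (induction "degree q" arbitrary: q n rule: less_induct)
  case less
  have rel: "fps_of_poly q * nth_deriv 1 = fps_of_poly n * nth_deriv 0"
    using less.prems(2) by (simp add: nth_deriv_def)
  show False
  proof (cases "poly q radius = 0 \<and> poly n radius = 0")
    case False
    then show ?thesis using regular_contradiction[OF rel] pole_contradiction[OF rel] by blast
  next
    case True
    then obtain q1 n1 where fac: "q = [:- radius, 1:] * q1" "n = [:- radius, 1:] * n1"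
      by (auto simp: poly_eq_0_iff_dvd elim!: dvdE)
    have "q1 \<noteq> 0" using less.prems(1) fac(1) by auto
    then have "degree q1 < degree q" unfolding fac(1) by (subst degree_mult_eq) auto
    moreover have "fps_of_poly [:- radius, 1:] * (fps_of_poly q1 * fps_deriv (Abs_fps a)) =
        fps_of_poly [:- radius, 1:] * (fps_of_poly n1 * Abs_fps a)"
      using less.prems(2) unfolding fac fps_of_poly_mult by (simp only: mult.assoc)
    moreover have "fps_of_poly [:- radius, 1:] \<noteq> 0" by (metis fps_of_poly_eq_iff fps_of_poly_0 pCons_eq_0_iff one_neq_zero)
    ultimately show ?thesis using less.hyps[OF _ \<open>q1 \<noteq> 0\<close>] by (metis mult_left_cancel)
  qed
qed

end

section \<open>Growth of the walk numbers\<close>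

text \<open>
  By the Cauchy-Schwarz inequality, a sum of squares is at least the square of the sum divided by
  the number of terms.
\<close>

lemma diag_coeff_lower: "real d ^ (2 * n) \<le> real (diag_coeff d n) * real (n + 1) ^ d"
proof (induction d arbitrary: n)
  case 0
  show ?case by (cases n) auto
next
  case (Suc d)
  have "real (Suc d) ^ (2 * n) = ((real d + 1) ^ n) ^ 2" by (simp add: power_mult mult.commute power_even_eq add.commute)
  also have "(real d + 1) ^ n = (\<Sum>k\<le>n. real (n choose k) * real d ^ k)" by (simp add: binomial_ring)
  also have "\<dots> ^ 2 \<le> (\<Sum>k\<le>n. (real (n choose k) * real d ^ k) ^ 2) * real (n + 1)"
    using sum_squared_le_sum_of_squares[of "\<lambda>k. real (n choose k) * real d ^ k" "{..n}"] by simp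
  also have "\<dots> \<le> (\<Sum>k\<le>n. real ((n choose k) ^ 2 * diag_coeff d k) * real (n + 1) ^ d) * real (n + 1)"
  proof (intro mult_right_mono sum_mono)
    fix k assume k: "k \<in> {..n}"
    have "(real (n choose k) * real d ^ k) ^ 2 = real (n choose k) ^ 2 * real d ^ (2 * k)"
      by (simp add: power_mult_distrib power_mult mult.commute power_even_eq)
    also have "\<dots> \<le> real (n choose k) ^ 2 * (real (diag_coeff d k) * real (k + 1) ^ d)"
      by (intro mult_left_mono Suc.IH) auto
    also have "\<dots> \<le> real (n choose k) ^ 2 * (real (diag_coeff d k) * real (n + 1) ^ d)"
      using k by (intro mult_left_mono power_mono) auto
    finally show "(real (n choose k) * real d ^ k) ^ 2 \<le> real ((n choose k) ^ 2 * diag_coeff d k) * real (n + 1) ^ d"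
      by (simp add: mult_ac)
  qed auto
  also have "\<dots> = real (diag_coeff (Suc d) n) * real (n + 1) ^ Suc d"
    unfolding sum_distrib_right[symmetric] by (simp add: mult_ac)
  finally show ?case .
qed

text \<open>
  \<open>binomial (2n) n ^ 2 * (n + 1) / 16^n\<close> decreases, because
  \<open>(2n + 1)^2 (n + 2) \<le> 4 (n + 1)^3\<close>.
\<close>

lemma central_binomial_upper: "real ((2 * n) choose n) \<le> 4 ^ n / sqrt (real (n + 1))"
proof -
  have "real ((2 * n) choose n) ^ 2 * real (n + 1) \<le> 16 ^ n"
  proof (induction n)
    case (Suc n)
    let ?b = "real ((2 * n) choose n)" and ?b' = "real ((2 * Suc n) choose Suc n)"
    have "real (n + 1) * ?b' = 2 * (2 * real n + 1) * ?b"
    proof -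
      have f: "fact (2 * Suc n) = 2 * (real n + 1) * ((2 * real n + 1) * fact (2 * n))"
        "fact (Suc n) = (real n + 1) * fact n" by (simp_all add: algebra_simps)
      have b: "real ((2 * m) choose m) = fact (2 * m) / (fact m * fact m)" for m
      proof -
        have "m \<le> 2 * m" "2 * m - m = m" by simp_all
        then show ?thesis using binomial_fact[of m "2 * m", where 'a = real] by simp
      qed
      have "x * (2 * x * (y * F) / (x * k * (x * k))) = 2 * y * (F / (k * k))"
        if "x > 0" "k > 0" for x y F k :: real
        using that by (simp add: field_simps)
      from this[of "real n + 1" "fact n"]
      have "(real n + 1) * (2 * (real n + 1) * (y * F) / ((real n + 1) * fact n * ((real n + 1) * fact n))) =
        2 * y * (F / (fact n * fact n))" for y F :: real by (simp only: fact_gt_zero add_nonneg_pos of_nat_0_le_iff zero_less_one)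
      moreover have "real (n + 1) = real n + 1" by simp
      ultimately show ?thesis unfolding b f by (simp only:)
    qed
    then have b': "?b' = 2 * (2 * real n + 1) * ?b / real (n + 1)" by (simp add: field_simps)
    have "?b' ^ 2 * real (Suc n + 1) = 4 * ?b ^ 2 * ((2 * real n + 1) ^ 2 * real (n + 2)) / real (n + 1) ^ 2"
      unfolding b' by (simp add: power_mult_distrib power_divide) (simp add: power2_eq_square algebra_simps)
    also have "\<dots> \<le> 4 * ?b ^ 2 * (4 * real (n + 1) ^ 3) / real (n + 1) ^ 2"
      by (intro divide_right_mono mult_left_mono) (auto simp: power2_eq_square power3_eq_cube algebra_simps)
    also have "\<dots> = 16 * (?b ^ 2 * real (n + 1))" by (simp add: power2_eq_square power3_eq_cube)
    also have "\<dots> \<le> 16 ^ Suc n" using Suc.IH by simp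
    finally show ?case .
  qed simp
  then have "(real ((2 * n) choose n) * sqrt (real (n + 1))) ^ 2 \<le> (4 ^ n) ^ 2"
  proof -
    have "((4 :: real) ^ n) ^ 2 = 16 ^ n" by (simp add: power2_eq_square flip: power_mult_distrib)
    moreover assume "real ((2 * n) choose n) ^ 2 * real (n + 1) \<le> 16 ^ n"
    ultimately show ?thesis by (simp add: power_mult_distrib)
  qed
  then have "real ((2 * n) choose n) * sqrt (real (n + 1)) \<le> 4 ^ n"
    by (rule power2_le_imp_le) simp
  then show ?thesis by (simp add: field_simps)
qed

lemma binomial_upper: "real (j choose i) \<le> 2 * 2 ^ j / sqrt (real (j + 1))"
proof -
  define t where "t = (j + 1) div 2"
  have "real (j choose i) \<le> real (j choose (j div 2))" using binomial_maximum[of j i] by simp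
  also have "\<dots> \<le> 2 ^ j / sqrt (real (t + 1))"
  proof (cases "even j")
    case True
    then have "j = 2 * t" "j div 2 = t" by (auto simp: t_def elim!: evenE)
    then show ?thesis using central_binomial_upper[of t] by (simp add: power_mult)
  next
    case False
    then obtain s where j: "j = 2 * s + 1" by (auto elim: oddE)
    have t: "t = Suc s" by (simp add: t_def j)
    have "(2 * t) choose t = (j choose s) + (j choose Suc s)" by (simp add: t j)
    moreover have "j choose Suc s = j choose s" using binomial_symmetric[of s j] by (simp add: j)
    ultimately have "2 * real (j choose s) = real ((2 * t) choose t)" by simp
    then show ?thesis using central_binomial_upper[of t] by (simp add: t j power_mult)
  qed
  also have "\<dots> \<le> 2 ^ j / (sqrt (real (j + 1)) / 2)"
  proof (intro divide_left_mono mult_pos_pos)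
    have "sqrt (real (j + 1)) / 2 = sqrt (real (j + 1) / 4)" by (simp add: real_sqrt_divide)
    also have "\<dots> \<le> sqrt (real (t + 1))"
    proof (rule real_sqrt_le_mono)
      have "j + 1 \<le> 4 * (t + 1)" unfolding t_def by presburger
      then have "real (j + 1) \<le> real (4 * (t + 1))" by (rule of_nat_mono)
      then show "real (j + 1) / 4 \<le> real (t + 1)" by simp
    qed
    finally show "sqrt (real (j + 1)) / 2 \<le> sqrt (real (t + 1))" .
  qed auto
  finally show ?thesis by (simp add: mult.commute)
qed

lemma binomial_sum: "(\<Sum>k\<le>n. real (n choose k) * q ^ k) = (1 + q) ^ n"
  using binomial_ring[of q 1 n] by (simp add: add.commute)

text \<open>
  The expectation of \<open>1/(K + 1)\<close> for a binomially distributed \<open>K\<close>: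
  absorbing \<open>1/(k + 1)\<close> into the binomial coefficient leaves a sum of the same
  kind.
\<close>

lemma binomial_sum_reciprocal:
  assumes q: "q \<ge> 1"
  shows "(\<Sum>k\<le>n. real (n choose k) * q ^ k / real (k + 1)) \<le> 2 * (1 + q) ^ n / real (n + 1)"
proof -
  have "q * real (n + 1) * (\<Sum>k\<le>n. real (n choose k) * q ^ k / real (k + 1)) =
      (\<Sum>k\<le>n. real (Suc n choose Suc k) * q ^ Suc k)"
    unfolding sum_distrib_left
  proof (intro sum.cong refl)
    fix k
    have "real (Suc k) * real (Suc n choose Suc k) = real (Suc n) * real (n choose k)"
      using Suc_times_binomial[of k n] by (metis of_nat_mult)
    then show "q * real (n + 1) * (real (n choose k) * q ^ k / real (k + 1)) =
        real (Suc n choose Suc k) * q ^ Suc k"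
      by (simp add: field_simps del: binomial_Suc_Suc)
  qed
  also have "\<dots> \<le> (\<Sum>k\<le>Suc n. real (Suc n choose k) * q ^ k)"
    by (subst sum.atMost_Suc_shift) simp
  also have "\<dots> = (1 + q) * (1 + q) ^ n" unfolding binomial_sum by simp
  also have "\<dots> \<le> (2 * q) * (1 + q) ^ n" using q by (intro mult_right_mono) auto
  finally have "q * (real (n + 1) * (\<Sum>k\<le>n. real (n choose k) * q ^ k / real (k + 1))) \<le> q * (2 * (1 + q) ^ n)"
    by (simp add: mult_ac)
  then have "real (n + 1) * (\<Sum>k\<le>n. real (n choose k) * q ^ k / real (k + 1)) \<le> 2 * (1 + q) ^ n"
    by (rule mult_left_le_imp_le) (use q in simp)
  then show ?thesis by (simp add: field_simps)
qed

text \<open>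
  Reduced to \<open>binomial_sum_reciprocal\<close> by \<open>x \<le> s x^2 + 1/s\<close>,
  with \<open>x = 1 / sqrt (k + 1)\<close> and \<open>s = sqrt (n + 1)\<close>.
\<close>

lemma binomial_sum_sqrt:
  assumes q: "q \<ge> 1"
  shows "(\<Sum>k\<le>n. real (n choose k) * q ^ k / sqrt (real (k + 1))) \<le> 3 * (1 + q) ^ n / sqrt (real (n + 1))"
proof -
  let ?s = "sqrt (real (n + 1))"
  have s: "?s > 0" "?s * ?s = real (n + 1)" by simp_all
  have "(\<Sum>k\<le>n. real (n choose k) * q ^ k / sqrt (real (k + 1))) \<le>
      (\<Sum>k\<le>n. ?s * (real (n choose k) * q ^ k / real (k + 1)) + real (n choose k) * q ^ k / ?s)"
  proof (rule sum_mono)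
    fix k
    let ?x = "1 / sqrt (real (k + 1))"
    have "2 * ?x * (1 / ?s) \<le> ?x ^ 2 + (1 / ?s) ^ 2" by (rule sum_squares_bound)
    moreover have "0 \<le> ?x * (1 / ?s)" by simp
    ultimately have "?x * (1 / ?s) \<le> ?x ^ 2 + (1 / ?s) ^ 2" by (simp only: mult.assoc)
    then have "?x / ?s \<le> ?x ^ 2 + (1 / ?s) ^ 2" by simp
    then have "?s * (?x / ?s) \<le> ?s * (?x ^ 2 + (1 / ?s) ^ 2)" using s by (intro mult_left_mono) auto
    moreover have "?s * (?x / ?s) = ?x" using s(1) by simp
    moreover have "?s * (?x ^ 2 + (1 / ?s) ^ 2) = ?s / real (k + 1) + 1 / ?s"
    proof -
      have "?x ^ 2 = 1 / real (k + 1)" by (simp add: power_divide)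
      moreover have "y * (1 / y) ^ 2 = 1 / y" if "y > 0" for y :: real
        using that by (simp add: power2_eq_square)
      from this[OF s(1)] have "?s * (1 / ?s) ^ 2 = 1 / ?s" .
      ultimately show ?thesis by (simp only: distrib_left times_divide_eq_right mult_1_right)
    qed
    ultimately have "?x \<le> ?s / real (k + 1) + 1 / ?s" by (simp only:)
    then have "real (n choose k) * q ^ k * ?x \<le> real (n choose k) * q ^ k * (?s / real (k + 1) + 1 / ?s)"
      using q by (intro mult_left_mono) auto
    then show "real (n choose k) * q ^ k / sqrt (real (k + 1)) \<le>
        ?s * (real (n choose k) * q ^ k / real (k + 1)) + real (n choose k) * q ^ k / ?s"
      by (simp add: algebra_simps)
  qed
  also have "\<dots> = ?s * (\<Sum>k\<le>n. real (n choose k) * q ^ k / real (k + 1)) + (1 + q) ^ n / ?s"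
    by (simp only: sum.distrib sum_distrib_left sum_divide_distrib[symmetric] binomial_sum)
  also have "\<dots> \<le> ?s * (2 * (1 + q) ^ n / real (n + 1)) + (1 + q) ^ n / ?s"
    using s by (intro add_right_mono mult_left_mono binomial_sum_reciprocal q) auto
  also have "\<dots> = 3 * (1 + q) ^ n / ?s"
  proof -
    have "y * (2 * X / (y * y)) + X / y = 3 * X / y" if "y > 0" for X y :: real
      using that by (simp add: field_simps)
    from this[OF s(1)] show ?thesis by (simp only: s(2))
  qed
  finally show ?thesis .
qed

text \<open>
  The largest probability of a binomial distribution with success probability \<open>2/3\<close>.
  Writing \<open>1 + 2X = (1 + X) + X\<close> presents it as a mixture of distributions
  with success probability \<open>1/2\<close>, for which \<open>binomial_upper\<close> applies.
\<close>

lemma binomial_two_thirds_upper: "real (n choose k) * 2 ^ k \<le> 6 * 3 ^ n / sqrt (real (n + 1))"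
proof (cases "k \<le> n")
  case True
  have "real (n choose k) * 2 ^ k = (\<Sum>i\<le>k. real (n choose k) * real (k choose i))"
    using choose_row_sum[of k] by (simp flip: sum_distrib_left of_nat_sum)
  also have "\<dots> = (\<Sum>i\<le>k. real (n choose i) * real ((n - i) choose (k - i)))"
    using choose_mult True by (intro sum.cong refl) (metis atMost_iff of_nat_mult)
  also have "\<dots> \<le> (\<Sum>i\<le>k. real (n choose i) * (2 * 2 ^ (n - i) / sqrt (real (n - i + 1))))"
    by (intro sum_mono mult_left_mono binomial_upper) auto
  also have "\<dots> \<le> (\<Sum>i\<le>n. real (n choose i) * (2 * 2 ^ (n - i) / sqrt (real (n - i + 1))))"
    using True by (intro sum_mono2) auto
  also have "\<dots> = (\<Sum>i\<le>n. real (n choose (n - i)) * (2 * 2 ^ (n - i) / sqrt (real (n - i + 1))))"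
    by (intro sum.cong refl) (simp flip: binomial_symmetric)
  also have "\<dots> = (\<Sum>i\<le>n. real (n choose i) * (2 * 2 ^ i / sqrt (real (i + 1))))"
    by (rule sum.reindex_bij_witness[of _ "\<lambda>i. n - i" "\<lambda>i. n - i"]) auto
  also have "\<dots> = 2 * (\<Sum>i\<le>n. real (n choose i) * 2 ^ i / sqrt (real (i + 1)))"
    by (simp add: sum_distrib_left mult_ac)
  also have "\<dots> \<le> 2 * (3 * (1 + 2) ^ n / sqrt (real (n + 1)))"
    by (intro mult_left_mono binomial_sum_sqrt) auto
  finally show ?thesis by simp
qed (simp add: binomial_eq_0)

lemma diag_coeff_2: "diag_coeff 2 n = (2 * n) choose n"
proof -
  have "diag_coeff 1 k = 1" for k
  proof -
    have "diag_coeff 1 k = (\<Sum>j\<in>{0}. (k choose j) ^ 2 * (if j = 0 then 1 else 0))"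
      unfolding One_nat_def diag_coeff.simps by (rule sum.mono_neutral_right) auto
    then show ?thesis by simp
  qed
  then have "diag_coeff (Suc 1) n = (2 * n) choose n"
    unfolding diag_coeff.simps(2) by (simp only: mult_1_right choose_square_sum)
  then show ?thesis by (simp only: Suc_1)
qed

text \<open>
  In the recursion, one factor \<open>(n choose k) * d^k\<close> of the square is estimated
  uniformly in \<open>k\<close>, and the other is summed. In the induction step the sum alone
  supplies the factor \<open>1/(n + 1)\<close>, and the trivial estimate
  \<open>(1 + d)^n\<close> suffices. In the base case the sum and the estimate
  \<open>binomial_two_thirds_upper\<close> supply \<open>1 / sqrt (n + 1)\<close> each.
\<close>

lemma diag_coeff_upper:
  assumes "d \<ge> 3"
  shows "\<exists>C. \<forall>n. real (n + 1) * real (diag_coeff d n) \<le> C * real (d ^ 2) ^ n"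
  using assms
proof (induction d rule: dec_induct)
  case base
  have "real (n + 1) * real (diag_coeff 3 n) \<le> 18 * real (3 ^ 2) ^ n" for n
  proof -
    have "diag_coeff 3 n = (\<Sum>k\<le>n. (n choose k) ^ 2 * ((2 * k) choose k))"
    proof -
      have "3 = Suc 2" by simp
      then show ?thesis by (simp only: diag_coeff.simps(2) diag_coeff_2)
    qed
    then have "real (diag_coeff 3 n) = (\<Sum>k\<le>n. real (n choose k) ^ 2 * real ((2 * k) choose k))" by simp
    also have "\<dots> \<le> (\<Sum>k\<le>n. real (n choose k) ^ 2 * (4 ^ k / sqrt (real (k + 1))))"
      by (intro sum_mono mult_left_mono central_binomial_upper) auto
    also have "\<dots> = (\<Sum>k\<le>n. (real (n choose k) * 2 ^ k) * (real (n choose k) * 2 ^ k / sqrt (real (k + 1))))"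
    proof (intro sum.cong refl)
      fix k
      have "(4::real) ^ k = 2 ^ k * 2 ^ k" by (simp flip: power_mult_distrib)
      then show "real (n choose k) ^ 2 * (4 ^ k / sqrt (real (k + 1))) =
          (real (n choose k) * 2 ^ k) * (real (n choose k) * 2 ^ k / sqrt (real (k + 1)))"
        by (simp add: power2_eq_square)
    qed
    also have "\<dots> \<le> (\<Sum>k\<le>n. (6 * 3 ^ n / sqrt (real (n + 1))) * (real (n choose k) * 2 ^ k / sqrt (real (k + 1))))"
      by (intro sum_mono mult_right_mono binomial_two_thirds_upper) auto
    also have "\<dots> = (6 * 3 ^ n / sqrt (real (n + 1))) * (\<Sum>k\<le>n. real (n choose k) * 2 ^ k / sqrt (real (k + 1)))"
      by (simp only: sum_distrib_left)
    also have "\<dots> \<le> (6 * 3 ^ n / sqrt (real (n + 1))) * (3 * (1 + 2) ^ n / sqrt (real (n + 1)))"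
      by (intro mult_left_mono binomial_sum_sqrt) auto
    also have "\<dots> = 18 * 9 ^ n / real (n + 1)" by (simp flip: power_mult_distrib)
    finally show ?thesis by (simp add: field_simps)
  qed
  then show ?case by blast
next
  case (step d)
  then obtain C where C: "\<And>n. real (n + 1) * real (diag_coeff d n) \<le> C * real (d ^ 2) ^ n" by blast
  have C0: "C \<ge> 0" using C[of 0] by (metis mult.right_neutral mult_nonneg_nonneg of_nat_0_le_iff order_trans power_0)
  have "real (n + 1) * real (diag_coeff (Suc d) n) \<le> 2 * C * real (Suc d ^ 2) ^ n" for n
  proof -
    have "real (diag_coeff (Suc d) n) = (\<Sum>k\<le>n. real (n choose k) ^ 2 * real (diag_coeff d k))" by simp
    also have "\<dots> \<le> (\<Sum>k\<le>n. C * (1 + real d) ^ n * (real (n choose k) * real d ^ k / real (k + 1)))"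
    proof (rule sum_mono)
      fix k assume k: "k \<in> {..n}"
      have "real (diag_coeff d k) \<le> C * real (d ^ 2) ^ k / real (k + 1)"
        using C[of k] by (simp add: field_simps)
      then have "real (n choose k) ^ 2 * real (diag_coeff d k) \<le> real (n choose k) ^ 2 * (C * real (d ^ 2) ^ k / real (k + 1))"
        by (intro mult_left_mono) auto
      also have "\<dots> = (real (n choose k) * real d ^ k) * (C * (real (n choose k) * real d ^ k / real (k + 1)))"
        by (simp add: power2_eq_square power_mult_distrib mult_ac)
      also have "\<dots> \<le> (1 + real d) ^ n * (C * (real (n choose k) * real d ^ k / real (k + 1)))"
      proof (rule mult_right_mono)
        show "real (n choose k) * real d ^ k \<le> (1 + real d) ^ n"
          unfolding binomial_sum[symmetric] using k by (intro member_le_sum) auto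
      qed (use C0 in auto)
      finally show "real (n choose k) ^ 2 * real (diag_coeff d k) \<le>
          C * (1 + real d) ^ n * (real (n choose k) * real d ^ k / real (k + 1))" by (simp add: mult_ac)
    qed
    also have "\<dots> = C * (1 + real d) ^ n * (\<Sum>k\<le>n. real (n choose k) * real d ^ k / real (k + 1))"
      by (simp only: sum_distrib_left)
    also have "\<dots> \<le> C * (1 + real d) ^ n * (2 * (1 + real d) ^ n / real (n + 1))"
      using C0 step by (intro mult_left_mono binomial_sum_reciprocal) auto
    also have "\<dots> = 2 * C * real (Suc d ^ 2) ^ n / real (n + 1)"
    proof -
      have "real (Suc d ^ 2) = (1 + real d) * (1 + real d)"
        by (simp add: power2_eq_square algebra_simps)
      then show ?thesis by (simp only: power_mult_distrib) simp
    qed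
    finally show ?thesis by (simp add: field_simps)
  qed
  then show ?case by blast
qed


section \<open>Reciprocals and logarithmic derivatives of the walk series\<close>

lemma lucas_growth_not_holonomic:
  fixes a :: "nat \<Rightarrow> nat" and R c C :: real
  assumes a0: "a 0 = 1" and lucas: "lucas_property (\<lambda>n. int (a n))"
    and R: "R > 0" and c: "c > 0"
    and upper: "\<And>n. real (n + 1) * real (a n) \<le> C * R ^ n"
    and lower: "\<And>n. c * R ^ n \<le> real (a n) * real (n + 1) ^ T"
  defines "F \<equiv> Abs_fps (\<lambda>n. of_nat (a n)) :: complex fps"
  shows "\<not> algebraic_fps (fps_deriv F / F)" "\<not> holonomic (1 / F)"
proof -
  let ?a = "\<lambda>n. int (a n)"
  have irrational: "fps_of_poly Q * fps_deriv (Abs_fps ?a) \<noteq> fps_of_poly N * Abs_fps ?a"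
    if Q: "Q \<noteq> 0" for Q N :: "int poly"
  proof
    assume rel: "fps_of_poly Q * fps_deriv (Abs_fps ?a) = fps_of_poly N * Abs_fps ?a"
    let ?r = "map_poly real_of_int"
    have "?r Q \<noteq> 0" using Q by (metis coeff_map_poly map_poly_eq_0_iff of_int_0 of_int_eq_0_iff)
    moreover have "fps_of_poly (?r Q) * fps_deriv (Abs_fps (\<lambda>n. real (a n))) =
        fps_of_poly (?r N) * Abs_fps (\<lambda>n. real (a n))"
    proof (rule fps_ext)
      fix n
      have "real_of_int ((fps_of_poly Q * fps_deriv (Abs_fps ?a)) $ n) =
          real_of_int ((fps_of_poly N * Abs_fps ?a) $ n)" by (simp only: rel)
      then show "(fps_of_poly (?r Q) * fps_deriv (Abs_fps (\<lambda>n. real (a n)))) $ n =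
          (fps_of_poly (?r N) * Abs_fps (\<lambda>n. real (a n))) $ n"
        by (simp add: fps_mult_nth coeff_map_poly)
    qed
    ultimately show False by (rule no_first_order_equation[OF R c upper lower])
  qed
  have F: "F = Abs_fps (\<lambda>n. of_int (?a n))" by (simp add: F_def)
  show "\<not> algebraic_fps (fps_deriv F / F)" "\<not> holonomic (1 / F)"
    unfolding F using reciprocal_not_holonomic[of ?a] a0 lucas irrational
    unfolding lucas_property_def by auto
qed

lemma diag_coeff_0: "diag_coeff d 0 = 1"
  by (induction d) auto

lemma F_series_inverse_not_holonomic:
  assumes d: "d \<ge> 3"
  shows "\<not> holonomic (1 / F_series d)"
proof -
  obtain C where C: "\<And>n. real (n + 1) * real (diag_coeff d n) \<le> C * real (d ^ 2) ^ n"
    using diag_coeff_upper[OF d] by blast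
  have lower: "1 * real (d ^ 2) ^ n \<le> real (diag_coeff d n) * real (n + 1) ^ d" for n
    using diag_coeff_lower[of d n] by (simp add: power_mult)
  have R: "real (d ^ 2) > 0" using d by simp
  have F: "F_series d = Abs_fps (\<lambda>n. of_nat (diag_coeff d n))"
    by (intro fps_ext) (simp add: F_series_def walk_ratio_eq)
  show ?thesis
    unfolding F by (rule lucas_growth_not_holonomic(2)[OF diag_coeff_0 lucas_diag_coeff R zero_less_one C lower])
qed

lemma A_series_not_holonomic:
  assumes d: "d \<ge> 2"
  shows "\<not> algebraic_fps (fps_deriv (A_series d) / A_series d)" "\<not> holonomic (1 / A_series d)"
proof -
  define a where "a n = ((2 * n) choose n) * diag_coeff d n" for n
  have A: "A_series d = Abs_fps (\<lambda>n. of_nat (a n))"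
    by (simp add: A_series_def num_closed_walks_eq a_def)
  have a0: "a 0 = 1" by (simp add: a_def diag_coeff_0)
  have lucas: "lucas_property (\<lambda>n. int (a n))"
    using lucas_property_mult[OF lucas_central_binomial lucas_diag_coeff] by (simp add: a_def)
  have central_le: "real ((2 * n) choose n) \<le> 4 ^ n" for n
    using central_binomial_upper[of n]
    by (rule order_trans) (simp add: divide_le_eq mult_left_le)
  have "\<exists>C. \<forall>n. real (n + 1) * real (a n) \<le> C * (4 * real (d ^ 2)) ^ n"
  proof (cases "d = 2")
    case True
    have "real (n + 1) * real (a n) \<le> 1 * (4 * real (d ^ 2)) ^ n" for n
    proof -
      have "real (a n) \<le> (4 ^ n / sqrt (real (n + 1))) * (4 ^ n / sqrt (real (n + 1)))"
        unfolding a_def True diag_coeff_2 of_nat_mult by (intro mult_mono central_binomial_upper) auto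
      also have "\<dots> = 16 ^ n / real (n + 1)" by (simp flip: power_mult_distrib)
      finally show ?thesis unfolding True by (simp add: field_simps)
    qed
    then show ?thesis by blast
  next
    case False
    with d have "d \<ge> 3" by simp
    then obtain C where C: "\<And>n. real (n + 1) * real (diag_coeff d n) \<le> C * real (d ^ 2) ^ n"
      using diag_coeff_upper by blast
    have "real (n + 1) * real (a n) \<le> C * (4 * real (d ^ 2)) ^ n" for n
    proof -
      have "real ((2 * n) choose n) * (real (n + 1) * real (diag_coeff d n)) \<le> 4 ^ n * (C * real (d ^ 2) ^ n)"
        by (intro mult_mono central_le C) auto
      then show ?thesis by (simp add: a_def power_mult_distrib mult_ac)
    qed
    then show ?thesis by blast
  qed
  then obtain C where upper: "\<And>n. real (n + 1) * real (a n) \<le> C * (4 * real (d ^ 2)) ^ n" by blast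
  have lower: "1 * (4 * real (d ^ 2)) ^ n \<le> real (a n) * real (n + 1) ^ (2 + d)" for n
  proof -
    have "real 2 ^ (2 * n) * real d ^ (2 * n) \<le>
        (real (diag_coeff 2 n) * real (n + 1) ^ 2) * (real (diag_coeff d n) * real (n + 1) ^ d)"
      by (intro mult_mono diag_coeff_lower) auto
    also have "\<dots> = real (a n) * real (n + 1) ^ (2 + d)"
      by (simp only: a_def diag_coeff_2 of_nat_mult power_add mult_ac)
    also have "real 2 ^ (2 * n) * real d ^ (2 * n) = 1 * (4 * real (d ^ 2)) ^ n"
      by (simp add: power_mult power_mult_distrib)
    finally show ?thesis .
  qed
  from d have R: "4 * real (d ^ 2) > 0" by simp
  show "\<not> algebraic_fps (fps_deriv (A_series d) / A_series d)" "\<not> holonomic (1 / A_series d)"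
    unfolding A by (rule lucas_growth_not_holonomic[OF a0 lucas R zero_less_one upper lower])+
qed


theorem mainTheorem11:
  fixes d :: nat
  shows "(d \<ge> 2 \<longrightarrow>
            \<not> algebraic_fps (fps_deriv (A_series d) / A_series d) \<and>
            \<not> holonomic (1 / A_series d)) \<and>
         (d \<ge> 3 \<longrightarrow> \<not> holonomic (1 / F_series d))"
  using A_series_not_holonomic F_series_inverse_not_holonomic by blast

end
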